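(* Let $M$ be a regular matroid with a triangulating circuit-cocircuit signature $(\sigma,\sigma^* )$. Let $\vec f$ be an arc with support $\{f\}$ and let $\vec O_1,\vec O_2$ be $(\sigma,\sigma^* )$-compatible orientations with $[\vec f]\cdot\vec O_1=\vec O_2$ (i.e. $([\vec f]\cdot[\vec O_1])^\circ=\vec O_2$). Then $\vec O_1$ can be transformed into $\vec O_2$ by the following process: (1) reverse at most one signed circuit or signed cocircuit containing $f$ that is compatible with $\vec O_1$; (2) reverse $f$; (3) reverse at most one signed circuit or signed cocircuit containing $f$ that is compatible with the current orientation. (Reversing $\vec C$ compatible with $\vec O$ means replacing $\vec O$ by $\mathrm{rev}_C(\vec O)$.) Furthermore: (a) a reversal occurs in step (1) if and only if $\vec f\sim\vec O_1$; (b) a reversal occurs in step (3) if and only if $-\vec f\sim\vec O_2$; (c) if reversals occur in both steps (1) and (3), then one is a circuit reversal and the other a cocircuit reversal; (d) if reversals occur in both steps (1) and (3), with reversed signed circuit $\vec C$ and reversed signed cocircuit $\vec C^*$, then $C\cap C^*$ has exactly two elements, one of which is $f$, and with $g$ the element of $(C\cap C^* )\setminus\{f\}$ we have $\vec O_2=\mathrm{rev}_{(C\cup C^* )\setminus\{g\}}(\vec O_1)$.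
   Context: $M=M(A)$ is the regular matroid on finite $E$ represented by a real totally unimodular matrix $A$ of full row rank (bases: index sets of nonsingular maximal square submatrices; circuits: minimal sets in no basis; cocircuits: minimal sets meeting every basis). 1-chains are elements of $\mathbb Z^E$, $\vec P(x)$ the coefficient at $x$, $P$ the support; simple means coefficients in $\{-1,0,1\}$; an arc is a simple 1-chain with one-element support. A signed circuit (cocircuit) is a simple element of $\ker A$ (row space of $A$) whose support is a circuit (cocircuit). An orientation is a map $E\to\{+,-\}$; $\vec P\sim\vec O$ means the sign of $\vec P(x)$ equals $\vec O(x)$ for all $x\in P$; $\mathrm{rev}_P(\vec O)$ flips $\vec O$ on $P\subseteq E$. Circuit-cocircuit equivalence is generated by $\vec O\mapsto\mathrm{rev}_C(\vec O)$ for signed circuits/cocircuits $\vec C\sim\vec O$; $[\vec O]$ is the class. $S(M)=\mathbb Z^E/(\Lambda+\Lambda^* )$ with $\Lambda,\Lambda^*$ generated by signed circuits, signed cocircuits. Canonical action: for an arc $\vec f$ and class $G$, pick $\vec O\in G$ with $-\vec f\sim\vec O$ and set $[\vec f]\cdot G=[\mathrm{rev}_{\{f\}}(\vec O)]$ (well defined, extends to a simply transitive action of $S(M)$). A circuit signature $\sigma$ picks one signed circuit on each circuit; a cocircuit signature $\sigma^*$ likewise. Fourientations are maps $E\to$ subsets of $\{+,-\}$; $\vec F(B,\sigma)$ is $\{+,-\}$ on the basis $B$ and, at $x\notin B$, the sign of $\sigma(C_x)(x)$ with $C_x\subseteq B\cup\{x\}$ the fundamental circuit; $\vec F(B,\sigma^*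 )$ is $\{+,-\}$ off $B$ and, at $x\in B$, the sign of $\sigma^*(C^*_x)(x)$ with $C^*_x\subseteq(E\setminus B)\cup\{x\}$ the fundamental cocircuit. A 1-chain $\vec P$ is compatible with a fourientation $\vec F$ if the sign of $\vec P(x)$ lies in $\vec F(x)$ for all $x\in P$; $-\vec F$ swaps $+,-$. $(\sigma,\sigma^* )$ is triangulating if for all distinct bases $B_1,B_2$ no signed circuit is compatible with $\vec F(B_1,\sigma)\cap-\vec F(B_2,\sigma)$ and no signed cocircuit is compatible with $\vec F(B_1,\sigma^* )\cap-\vec F(B_2,\sigma^* )$. An orientation is $(\sigma,\sigma^* )$-compatible if all signed circuits compatible with it are in $\sigma$ and all signed cocircuits compatible with it are in $\sigma^*$; for triangulating signatures each class contains a unique one, denoted $[\vec O]^\circ$, and $s\cdot\vec O:=(s\cdot[\vec O])^\circ$ for compatible $\vec O$. *)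

theory Defs
  imports "HOL-Analysis.Analysis" "HOL-Algebra.Generated_Groups" "Jordan_Normal_Form.Determinant"
begin

no_notation Matrix.vec_index (infixl "$" 100)
no_notation Matrix.scalar_prod (infix "\<bullet>" 70)
hide_const (open) Matrix.mat Determinant.det

section \<open>Totally unimodular matrices and their matroids\<close>

text \<open>
  The ground set is the universe of a finite type \<open>'e\<close>. A matrix with columns indexed by \<open>'e\<close> is the
  list of its rows; an empty list is allowed, so that matroids of rank 0 are covered.
\<close>

type_synonym 'e row_matrix = "(real^'e) list"

text \<open>
  The \<open>k \<times> k\<close> matrix whose rows and columns are those of \<open>A\<close> with indices \<open>p 0, \<dots>, p (k - 1)\<close> and
  \<open>q 0, \<dots>, q (k - 1)\<close>. The order in which the rows and columns of a submatrix are listed changes its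
  determinant only by a sign.
\<close>

definition submat :: "'e::finite row_matrix \<Rightarrow> (nat \<Rightarrow> nat) \<Rightarrow> (nat \<Rightarrow> 'e) \<Rightarrow> nat \<Rightarrow> real Matrix.mat" where
  "submat A p q k = Matrix.mat k k (\<lambda>(i, j). (A ! p i) $ q j)"

definition totally_unimodular :: "'e::finite row_matrix \<Rightarrow> bool" where
  "totally_unimodular A \<longleftrightarrow>
     (\<forall>k p q. inj_on p {..<k} \<and> p ` {..<k} \<subseteq> {..<length A} \<and> inj_on q {..<k}
        \<longrightarrow> Determinant.det (submat A p q k) \<in> {-1, 0, 1})"

definition full_row_rank :: "'e::finite row_matrix \<Rightarrow> bool" where
  "full_row_rank A \<longleftrightarrow> distinct A \<and> independent (set A)"

definition kernel :: "'e::finite row_matrix \<Rightarrow> (real^'e) set" where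
  "kernel A = {v. \<forall>a\<in>set A. a \<bullet> v = 0}"

definition row_space :: "'e::finite row_matrix \<Rightarrow> (real^'e) set" where
  "row_space A = span (set A)"

definition is_basis :: "'e::finite row_matrix \<Rightarrow> 'e set \<Rightarrow> bool" where
  "is_basis A B \<longleftrightarrow>
     (\<exists>q. bij_betw q {..<length A} B \<and> Determinant.det (submat A id q (length A)) \<noteq> 0)"

definition is_circuit :: "'e::finite row_matrix \<Rightarrow> 'e set \<Rightarrow> bool" where
  "is_circuit A C \<longleftrightarrow>
     \<not> (\<exists>B. is_basis A B \<and> C \<subseteq> B) \<and> (\<forall>D. D \<subset> C \<longrightarrow> (\<exists>B. is_basis A B \<and> D \<subseteq> B))"

definition is_cocircuit :: "'e::finite row_matrix \<Rightarrow> 'e set \<Rightarrow> bool" where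
  "is_cocircuit A C \<longleftrightarrow>
     (\<forall>B. is_basis A B \<longrightarrow> C \<inter> B \<noteq> {}) \<and> (\<forall>D. D \<subset> C \<longrightarrow> (\<exists>B. is_basis A B \<and> D \<inter> B = {}))"

definition fund_circuit :: "'e::finite row_matrix \<Rightarrow> 'e set \<Rightarrow> 'e \<Rightarrow> 'e set" where
  "fund_circuit A B x = (THE C. is_circuit A C \<and> C \<subseteq> insert x B)"

definition fund_cocircuit :: "'e::finite row_matrix \<Rightarrow> 'e set \<Rightarrow> 'e \<Rightarrow> 'e set" where
  "fund_cocircuit A B x = (THE C. is_cocircuit A C \<and> C \<subseteq> insert x (- B))"

section \<open>Chains and signed circuits\<close>

type_synonym 'e chain = "int^'e"

definition supp :: "'e::finite chain \<Rightarrow> 'e set" where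
  "supp P = {x. P $ x \<noteq> 0}"

definition simple_chain :: "'e::finite chain \<Rightarrow> bool" where
  "simple_chain P \<longleftrightarrow> (\<forall>x. P $ x \<in> {-1, 0, 1})"

definition is_arc :: "'e::finite chain \<Rightarrow> bool" where
  "is_arc P \<longleftrightarrow> simple_chain P \<and> (\<exists>f. supp P = {f})"

definition real_chain :: "'e::finite chain \<Rightarrow> real^'e" where
  "real_chain P = (\<chi> x. real_of_int (P $ x))"

definition signed_circuit :: "'e::finite row_matrix \<Rightarrow> 'e chain \<Rightarrow> bool" where
  "signed_circuit A C \<longleftrightarrow> simple_chain C \<and> real_chain C \<in> kernel A \<and> is_circuit A (supp C)"

definition signed_cocircuit :: "'e::finite row_matrix \<Rightarrow> 'e chain \<Rightarrow> bool" where
  "signed_cocircuit A C \<longleftrightarrow> simple_chain C \<and> real_chain C \<in> row_space A \<and> is_cocircuit A (supp C)"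

section \<open>Orientations and circuit-cocircuit equivalence\<close>

datatype sign = Plus | Minus

fun opposite :: "sign \<Rightarrow> sign" where
  "opposite Plus = Minus"
| "opposite Minus = Plus"

text \<open>Only meaningful at elements \<open>x\<close> of the support of \<open>P\<close>.\<close>

definition chain_sign :: "'e::finite chain \<Rightarrow> 'e \<Rightarrow> sign" where
  "chain_sign P x = (if P $ x > 0 then Plus else Minus)"

type_synonym 'e orientation = "'e \<Rightarrow> sign"

definition agrees :: "'e::finite chain \<Rightarrow> 'e orientation \<Rightarrow> bool" where
  "agrees P Q \<longleftrightarrow> (\<forall>x\<in>supp P. chain_sign P x = Q x)"

definition reverse_on :: "'e set \<Rightarrow> 'e orientation \<Rightarrow> 'e orientation" where
  "reverse_on X Q = (\<lambda>x. if x \<in> X then opposite (Q x) else Q x)"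

definition reversal_step :: "'e::finite row_matrix \<Rightarrow> 'e orientation \<Rightarrow> 'e orientation \<Rightarrow> bool" where
  "reversal_step A Q Q' \<longleftrightarrow>
     (\<exists>C. (signed_circuit A C \<or> signed_cocircuit A C) \<and> agrees C Q \<and> Q' = reverse_on (supp C) Q)"

definition orientation_class :: "'e::finite row_matrix \<Rightarrow> 'e orientation \<Rightarrow> 'e orientation set" where
  "orientation_class A Q = {Q'. equivclp (reversal_step A) Q Q'}"

section \<open>The sandpile group and its canonical action\<close>

definition chain_group :: "('e::finite chain) monoid" where
  "chain_group = \<lparr>carrier = UNIV, mult = (+), one = 0\<rparr>"

definition circuit_lattice :: "'e::finite row_matrix \<Rightarrow> 'e chain set" where
  "circuit_lattice A = generate chain_group {C. signed_circuit A C}"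

definition cocircuit_lattice :: "'e::finite row_matrix \<Rightarrow> 'e chain set" where
  "cocircuit_lattice A = generate chain_group {C. signed_cocircuit A C}"

definition sandpile_lattice :: "'e::finite row_matrix \<Rightarrow> 'e chain set" where
  "sandpile_lattice A = circuit_lattice A <#>\<^bsub>chain_group\<^esub> cocircuit_lattice A"

definition sandpile_group :: "'e::finite row_matrix \<Rightarrow> ('e chain set) monoid" where
  "sandpile_group A = chain_group Mod sandpile_lattice A"

definition sandpile_class :: "'e::finite row_matrix \<Rightarrow> 'e chain \<Rightarrow> 'e chain set" where
  "sandpile_class A P = sandpile_lattice A #>\<^bsub>chain_group\<^esub> P"

lemma sandpile_class_in_carrier: "sandpile_class A P \<in> carrier (sandpile_group A)"
  by (auto simp: sandpile_class_def sandpile_group_def FactGroup_def RCOSETS_def chain_group_def)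

definition arc_action ::
    "'e::finite row_matrix \<Rightarrow> 'e chain \<Rightarrow> 'e orientation set \<Rightarrow> 'e orientation set" where
  "arc_action A F G =
     orientation_class A (reverse_on (supp F) (SOME Q. Q \<in> G \<and> agrees (- F) Q))"

text \<open>
  Extension of the action of arcs to the whole group: every 1-chain is a sum of arcs, and an element
  of the group represented by such a sum acts by letting the summands act one after the other.
\<close>

definition canonical_action ::
    "'e::finite row_matrix \<Rightarrow> 'e chain set \<Rightarrow> 'e orientation set \<Rightarrow> 'e orientation set" where
  "canonical_action A s G =
     (THE G'. \<exists>Fs. (\<forall>F\<in>set Fs. is_arc F) \<and> sandpile_class A (sum_list Fs) = s
                 \<and> G' = fold (arc_action A) Fs G)"

section \<open>Signatures and fourientations\<close>

text \<open>
  A signature is a function choosing a signed (co)circuit on each (co)circuit; its values elsewhere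
  are irrelevant. A signed (co)circuit \<open>C\<close> belongs to the signature \<open>\<sigma>\<close> iff \<open>\<sigma> (supp C) = C\<close>.
\<close>

type_synonym 'e signature = "'e set \<Rightarrow> 'e chain"

definition circuit_signature :: "'e::finite row_matrix \<Rightarrow> 'e signature \<Rightarrow> bool" where
  "circuit_signature A \<sigma> \<longleftrightarrow> (\<forall>C. is_circuit A C \<longrightarrow> signed_circuit A (\<sigma> C) \<and> supp (\<sigma> C) = C)"

definition cocircuit_signature :: "'e::finite row_matrix \<Rightarrow> 'e signature \<Rightarrow> bool" where
  "cocircuit_signature A \<sigma>' \<longleftrightarrow>
     (\<forall>C. is_cocircuit A C \<longrightarrow> signed_cocircuit A (\<sigma>' C) \<and> supp (\<sigma>' C) = C)"

definition in_signature :: "'e::finite chain \<Rightarrow> 'e signature \<Rightarrow> bool" where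
  "in_signature C \<sigma> \<longleftrightarrow> \<sigma> (supp C) = C"

type_synonym 'e fourientation = "'e \<Rightarrow> sign set"

definition four_compatible :: "'e::finite chain \<Rightarrow> 'e fourientation \<Rightarrow> bool" where
  "four_compatible P F \<longleftrightarrow> (\<forall>x\<in>supp P. chain_sign P x \<in> F x)"

definition four_neg :: "'e fourientation \<Rightarrow> 'e fourientation" where
  "four_neg F = (\<lambda>x. opposite ` F x)"

definition four_inter :: "'e fourientation \<Rightarrow> 'e fourientation \<Rightarrow> 'e fourientation" where
  "four_inter F F' = (\<lambda>x. F x \<inter> F' x)"

definition circuit_fourientation ::
    "'e::finite row_matrix \<Rightarrow> 'e signature \<Rightarrow> 'e set \<Rightarrow> 'e fourientation" where
  "circuit_fourientation A \<sigma> B =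
     (\<lambda>x. if x \<in> B then {Plus, Minus} else {chain_sign (\<sigma> (fund_circuit A B x)) x})"

definition cocircuit_fourientation ::
    "'e::finite row_matrix \<Rightarrow> 'e signature \<Rightarrow> 'e set \<Rightarrow> 'e fourientation" where
  "cocircuit_fourientation A \<sigma>' B =
     (\<lambda>x. if x \<in> B then {chain_sign (\<sigma>' (fund_cocircuit A B x)) x} else {Plus, Minus})"

definition triangulating :: "'e::finite row_matrix \<Rightarrow> 'e signature \<Rightarrow> 'e signature \<Rightarrow> bool" where
  "triangulating A \<sigma> \<sigma>' \<longleftrightarrow>
     circuit_signature A \<sigma> \<and> cocircuit_signature A \<sigma>' \<and>
     (\<forall>B1 B2. is_basis A B1 \<and> is_basis A B2 \<and> B1 \<noteq> B2 \<longrightarrow>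
        \<not> (\<exists>C. signed_circuit A C \<and> four_compatible C
               (four_inter (circuit_fourientation A \<sigma> B1)
                           (four_neg (circuit_fourientation A \<sigma> B2)))) \<and>
        \<not> (\<exists>C. signed_cocircuit A C \<and> four_compatible C
               (four_inter (cocircuit_fourientation A \<sigma>' B1)
                           (four_neg (cocircuit_fourientation A \<sigma>' B2)))))"

section \<open>Compatible orientations\<close>

definition compatible_orientation ::
    "'e::finite row_matrix \<Rightarrow> 'e signature \<Rightarrow> 'e signature \<Rightarrow> 'e orientation \<Rightarrow> bool" where
  "compatible_orientation A \<sigma> \<sigma>' Q \<longleftrightarrow>
     (\<forall>C. signed_circuit A C \<and> agrees C Q \<longrightarrow> in_signature C \<sigma>) \<and>
     (\<forall>C. signed_cocircuit A C \<and> agrees C Q \<longrightarrow> in_signature C \<sigma>')"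

text \<open>
  The unique compatible orientation in a class, as a partial function: \<open>None\<close> stands for undefined,
  which does not occur for a class of orientations and a triangulating pair of signatures.
\<close>

definition compatible_rep :: "'e::finite row_matrix \<Rightarrow> 'e signature \<Rightarrow> 'e signature
    \<Rightarrow> 'e orientation set \<Rightarrow> 'e orientation option" where
  "compatible_rep A \<sigma> \<sigma>' G =
     (if \<exists>!Q. Q \<in> G \<and> compatible_orientation A \<sigma> \<sigma>' Q
      then Some (THE Q. Q \<in> G \<and> compatible_orientation A \<sigma> \<sigma>' Q) else None)"

definition orientation_action :: "'e::finite row_matrix \<Rightarrow> 'e signature \<Rightarrow> 'e signature
    \<Rightarrow> 'e chain set \<Rightarrow> 'e orientation \<Rightarrow> 'e orientation option" where
  "orientation_action A \<sigma> \<sigma>' s Q =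
     compatible_rep A \<sigma> \<sigma>' (canonical_action A s (orientation_class A Q))"

text \<open>
  Reversing at most one signed circuit or cocircuit that contains \<open>f\<close> and is compatible with the
  orientation \<open>Q\<close>, with result \<open>Q'\<close>; \<open>c\<close> records what is reversed, if anything.
\<close>

definition optional_reversal :: "'e::finite row_matrix \<Rightarrow> 'e \<Rightarrow> 'e chain option
    \<Rightarrow> 'e orientation \<Rightarrow> 'e orientation \<Rightarrow> bool" where
  "optional_reversal A f c Q Q' \<longleftrightarrow>
     (case c of
        None \<Rightarrow> Q' = Q
      | Some C \<Rightarrow> (signed_circuit A C \<or> signed_cocircuit A C) \<and> f \<in> supp C \<and> agrees C Q
                  \<and> Q' = reverse_on (supp C) Q)"

end

theory Submission
  imports Defs
begin

text \<open>
  Encode an orientation \<open>O\<close> as the indicator \<open>d O\<close> of its positive elements. Reversing a signed circuit or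
  cocircuit \<open>C\<close> compatible with \<open>O\<close> subtracts \<open>C\<close> from \<open>d O\<close>, and the arc \<open>F\<close> acts by adding \<open>F\<close>; hence
  \<open>d O\<^sub>1 + F - d O\<^sub>2 = a + b\<close> with an integral kernel vector \<open>a\<close> and an integral row space vector \<open>b\<close>.
  Since \<open>a\<close> and \<open>b\<close> are orthogonal and \<open>a x * b x \<le> 0\<close> wherever \<open>\<bar>a x + b x\<bar> \<le> 1\<close>, a sum \<open>a + b\<close> with
  entries in \<open>{-1, 0, 1}\<close> has \<open>a\<close> and \<open>b\<close> of disjoint support, and it splits conformally into signed circuits
  and cocircuits. This gives the well-definedness of the action. A signed circuit or cocircuit \<open>C\<close> with \<open>C\<close>
  compatible with \<open>O\<^sub>1\<close> and \<open>-C\<close> compatible with \<open>O\<^sub>2\<close> would force both \<open>C\<close> and \<open>-C\<close> into the signature, so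
  every piece of \<open>a + b\<close> must pass through \<open>f\<close> (or through the single other element where \<open>a\<close> and \<open>b\<close>
  cancel), which leaves at most one circuit and one cocircuit.
\<close>

section \<open>Bases, kernel and row space\<close>

lemma inner_vec_sum: "(a::real^'e) \<bullet> v = (\<Sum>x\<in>UNIV. a $ x * v $ x)"
  by (simp add: inner_vec_def)

lemma subspace_kernel: "subspace (kernel A)"
  by (auto simp: kernel_def subspace_def inner_add_right)

lemma subspace_row_space: "subspace (row_space A)"
  by (simp add: row_space_def)

lemma kernel_orthogonal_row_space:
  assumes "v \<in> kernel A" "w \<in> row_space A"
  shows "v \<bullet> w = 0"
proof -
  have "w \<in> span (set A)" using assms(2) by (simp add: row_space_def)
  then show ?thesis
    by (induction rule: span_induct_alt)
      (use assms(1) in \<open>auto simp: kernel_def inner_add_right inner_commute\<close>)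
qed

text \<open>Bridge from the determinants that define bases to inner products in
  \<open>real^'e\<close>: for a vector supported on \<open>B\<close> only the columns in
  \<open>B\<close> matter.\<close>

lemma submat_mult_vec:
  assumes q: "bij_betw q {..<r} B" and v: "\<And>x. x \<notin> B \<Longrightarrow> v $ x = 0"
  shows "submat A id q r *\<^sub>v Matrix.vec r (\<lambda>j. v $ q j) = Matrix.vec r (\<lambda>i. (A ! i) \<bullet> v)"
proof (rule eq_vecI)
  fix i assume "i < dim_vec (Matrix.vec r (\<lambda>i. (A ! i) \<bullet> v))"
  then have i: "i < r" by simp
  have "Matrix.vec_index (submat A id q r *\<^sub>v Matrix.vec r (\<lambda>j. v $ q j)) i = (\<Sum>j<r. (A ! i) $ q j * v $ q j)"
    using i by (simp add: submat_def scalar_prod_def lessThan_atLeast0)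
  also have "\<dots> = (\<Sum>x\<in>B. (A ! i) $ x * v $ x)"
    by (rule sum.reindex_bij_betw[OF q])
  also have "\<dots> = (A ! i) \<bullet> v"
    unfolding inner_vec_sum by (rule sum.mono_neutral_left) (auto simp: v)
  finally show "Matrix.vec_index (submat A id q r *\<^sub>v Matrix.vec r (\<lambda>j. v $ q j)) i
      = Matrix.vec_index (Matrix.vec r (\<lambda>i. (A ! i) \<bullet> v)) i" using i by simp
qed (simp add: submat_def)

lemma submat_carrier: "submat A p q k \<in> carrier_mat k k"
  by (simp add: submat_def)

lemma kernel_nth: "v \<in> kernel A \<longleftrightarrow> (\<forall>i<length A. (A ! i) \<bullet> v = 0)"
  unfolding kernel_def mem_Collect_eq all_set_conv_all_nth ..

lemma basis_kernel_eq_0: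
  assumes "is_basis A B" "v \<in> kernel A" "\<And>x. x \<notin> B \<Longrightarrow> v $ x = 0"
  shows "v = 0"
proof -
  obtain q where q: "bij_betw q {..<length A} B"
    and det: "Determinant.det (submat A id q (length A)) \<noteq> 0"
    using assms(1) by (auto simp: is_basis_def)
  let ?u = "Matrix.vec (length A) (\<lambda>j. v $ q j)"
  have "submat A id q (length A) *\<^sub>v ?u = Matrix.vec (length A) (\<lambda>i. (A ! i) \<bullet> v)"
    by (rule submat_mult_vec[OF q assms(3)])
  also have "\<dots> = 0\<^sub>v (length A)"
    using assms(2) by (intro eq_vecI) (auto simp: kernel_nth)
  finally have "submat A id q (length A) *\<^sub>v ?u = 0\<^sub>v (length A)" .
  then have u: "?u = 0\<^sub>v (length A)"
    using det det_0_iff_vec_prod_zero_field[OF submat_carrier] by (metis vec_carrier)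
  have "v $ x = 0" for x
  proof (cases "x \<in> B")
    case True
    then obtain j where "j < length A" "q j = x" using q by (auto simp: bij_betw_def)
    then show ?thesis using arg_cong[OF u, of "\<lambda>u. Matrix.vec_index u j"] by simp
  qed (use assms(3) in simp)
  then show ?thesis by (simp add: Finite_Cartesian_Product.vec_eq_iff)
qed

lemma row_space_coeffs:
  assumes "full_row_rank A" "w \<in> row_space A"
  obtains c where "w = (\<Sum>i<length A. c i *\<^sub>R (A ! i))"
proof -
  obtain c where "w = (\<Sum>a\<in>set A. c a *\<^sub>R a)"
    using assms(2) span_finite[of "set A"] by (auto simp: row_space_def)
  also have "\<dots> = (\<Sum>i<length A. c (A ! i) *\<^sub>R (A ! i))"
    using assms(1)
    by (subst sum.reindex_bij_betw[OF bij_betw_nth[of A "{..<length A}" "set A"], symmetric])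
      (auto simp: full_row_rank_def)
  finally show thesis by (rule that)
qed

text \<open>Dual to \<open>basis_kernel_eq_0\<close>: the coefficients of \<open>w\<close> in the
  rows form a null vector of the transposed basis submatrix.\<close>

lemma basis_row_space_eq_0:
  assumes "full_row_rank A" "is_basis A B" "w \<in> row_space A" "\<And>x. x \<in> B \<Longrightarrow> w $ x = 0"
  shows "w = 0"
proof -
  obtain q where q: "bij_betw q {..<length A} B"
    and det: "Determinant.det (submat A id q (length A)) \<noteq> 0"
    using assms(2) by (auto simp: is_basis_def)
  obtain c where c: "w = (\<Sum>i<length A. c i *\<^sub>R (A ! i))"
    using row_space_coeffs[OF assms(1,3)] .
  let ?T = "transpose_mat (submat A id q (length A))"
  let ?u = "Matrix.vec (length A) c"
  have "?T *\<^sub>v ?u = 0\<^sub>v (length A)"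
  proof (rule eq_vecI)
    fix j assume "j < dim_vec (0\<^sub>v (length A) :: real Matrix.vec)"
    then have j: "j < length A" by simp
    then have "q j \<in> B" using q by (auto simp: bij_betw_def)
    then have "0 = w $ q j" by (simp add: assms(4))
    also have "\<dots> = (\<Sum>i<length A. c i * (A ! i) $ q j)" by (simp add: c)
    also have "\<dots> = Matrix.vec_index (?T *\<^sub>v ?u) j"
      using j by (simp add: submat_def scalar_prod_def lessThan_atLeast0 mult.commute)
    finally show "Matrix.vec_index (?T *\<^sub>v ?u) j = Matrix.vec_index (0\<^sub>v (length A)) j" using j by simp
  qed (simp add: submat_def)
  moreover have "Determinant.det ?T \<noteq> 0" using det det_transpose[OF submat_carrier] by metis
  ultimately have u: "?u = 0\<^sub>v (length A)"
    using det_0_iff_vec_prod_zero_field[of ?T "length A"]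
    by (metis submat_carrier transpose_carrier_mat vec_carrier)
  have "c i = 0" if "i < length A" for i
    using arg_cong[OF u, of "\<lambda>u. Matrix.vec_index u i"] that by simp
  then show ?thesis by (simp add: c)
qed

text \<open>A null vector of a singular submatrix, extended by zero outside \<open>B\<close>, would
  be a nonzero kernel vector supported on \<open>B\<close>.\<close>

lemma is_basisI:
  fixes A :: "'e::finite row_matrix"
  assumes "card B = length A"
    and ind: "\<And>v. \<lbrakk>v \<in> kernel A; \<And>x. x \<notin> B \<Longrightarrow> v $ x = 0\<rbrakk> \<Longrightarrow> v = 0"
  shows "is_basis A B"
proof -
  obtain q where q: "bij_betw q {..<length A} B"
    using ex_bij_betw_nat_finite[of B] assms(1) by (auto simp: lessThan_atLeast0)
  have "Determinant.det (submat A id q (length A)) \<noteq> 0"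
  proof
    assume "Determinant.det (submat A id q (length A)) = 0"
    then obtain u where u: "u \<in> carrier_vec (length A)" "u \<noteq> 0\<^sub>v (length A)"
      "submat A id q (length A) *\<^sub>v u = 0\<^sub>v (length A)"
      using det_0_iff_vec_prod_zero_field[OF submat_carrier] by blast
    define v :: "real^'e" where "v = (\<chi> x. if x \<in> B then Matrix.vec_index u (the_inv_into {..<length A} q x) else 0)"
    have vq: "v $ q j = Matrix.vec_index u j" if "j < length A" for j
      using that q by (auto simp: v_def bij_betw_def the_inv_into_f_f)
    then have uv: "u = Matrix.vec (length A) (\<lambda>j. v $ q j)"
      using u(1) by (intro eq_vecI) auto
    have vB: "v $ x = 0" if "x \<notin> B" for x using that by (simp add: v_def)
    have "Matrix.vec (length A) (\<lambda>i. (A ! i) \<bullet> v) = 0\<^sub>v (length A)"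
      using submat_mult_vec[OF q vB, of A] u(3) uv by simp
    then have "v \<in> kernel A"
      unfolding kernel_nth by (metis index_vec index_zero_vec(1))
    then have "v = 0" using ind vB by blast
    then show False using u(2) uv by auto
  qed
  then show ?thesis using q by (auto simp: is_basis_def)
qed

section \<open>Dimension counts and existence of bases\<close>

lemma dim_supported: "dim {v::real^'e. \<forall>x. x \<notin> S \<longrightarrow> v $ x = 0} = card S"
  using dim_substandard_cart[where 'a = real, of S] by (simp add: Cartesian_Space.dim_vec_eq)

lemma dim_row_space: "full_row_rank A \<Longrightarrow> dim (row_space A) = length A"
  by (simp add: row_space_def full_row_rank_def dim_eq_card_independent distinct_card)

definition restrict_vec :: "'e set \<Rightarrow> real^'e \<Rightarrow> real^'e" where
  "restrict_vec S w = (\<chi> x. if x \<in> S then w $ x else 0)"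

lemma linear_restrict_vec: "linear (restrict_vec S)"
  by (rule linearI) (auto simp: restrict_vec_def Finite_Cartesian_Product.vec_eq_iff)

text \<open>The rows cut down to \<open>S\<close> span a proper subspace of the vectors supported on
  \<open>S\<close>. A nonzero vector of that space orthogonal to them pairs to zero with the full
  rows as well.\<close>

lemma kernel_vector_exists:
  fixes A :: "'e::finite row_matrix"
  assumes "length A < card S"
  obtains u where "u \<in> kernel A" "u \<noteq> 0" "\<And>x. x \<notin> S \<Longrightarrow> u $ x = 0"
proof -
  define U where "U = {v::real^'e. \<forall>x. x \<notin> S \<longrightarrow> v $ x = 0}"
  have subU: "subspace U" by (auto simp: U_def subspace_def)
  have "dim (restrict_vec S ` set A) \<le> card (restrict_vec S ` set A)"
    by (rule dim_le_card') simp
  also have "\<dots> \<le> length A"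
    by (meson List.finite_set card_image_le card_length le_trans)
  also have "\<dots> < dim U" using assms by (simp add: U_def dim_supported)
  finally have "span (restrict_vec S ` set A) \<noteq> span U"
    by (metis dim_span less_irrefl)
  moreover have "restrict_vec S ` set A \<subseteq> U" by (auto simp: restrict_vec_def U_def)
  ultimately have "span (restrict_vec S ` set A) \<subset> span U"
    by (simp add: psubset_eq span_mono)
  then obtain u where u: "u \<noteq> 0" "u \<in> span U"
    and orth: "\<And>y. y \<in> span (restrict_vec S ` set A) \<Longrightarrow> real_inner_class.orthogonal u y"
    by (rule orthogonal_to_subspace_exists_gen) blast
  have uU: "u \<in> U" using u(2) subU span_eq_iff by blast
  have "a \<bullet> u = 0" if "a \<in> set A" for a
  proof -
    have "u \<bullet> restrict_vec S a = 0"
      using orth span_base that unfolding real_inner_class.orthogonal_def by blast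
    moreover have "u \<bullet> restrict_vec S a = a \<bullet> u"
      unfolding inner_vec_sum by (rule sum.cong) (use uU in \<open>auto simp: restrict_vec_def U_def\<close>)
    ultimately show ?thesis by simp
  qed
  then have "u \<in> kernel A" by (simp add: kernel_def)
  then show thesis using that u(1) uU by (auto simp: U_def)
qed

text \<open>Here \<open>I\<close> is independent and \<open>S\<close> is spanning, both in vector
  form. A largest independent \<open>B\<close> between them is still spanning, so restriction to
  \<open>B\<close> is injective on the row space and bounds \<open>card B\<close> from below;
  \<open>kernel_vector_exists\<close> bounds it from above.\<close>

lemma basis_between:
  fixes A :: "'e::finite row_matrix"
  assumes rank: "full_row_rank A" and "I \<subseteq> S"
    and I: "\<And>v. \<lbrakk>v \<in> kernel A; \<And>x. x \<notin> I \<Longrightarrow> v $ x = 0\<rbrakk> \<Longrightarrow> v = 0"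
    and S: "\<And>w. \<lbrakk>w \<in> row_space A; \<And>x. x \<in> S \<Longrightarrow> w $ x = 0\<rbrakk> \<Longrightarrow> w = 0"
  obtains B where "is_basis A B" "I \<subseteq> B" "B \<subseteq> S"
proof -
  define P where "P B \<longleftrightarrow> I \<subseteq> B \<and> B \<subseteq> S \<and> (\<forall>v\<in>kernel A. (\<forall>x. x \<notin> B \<longrightarrow> v $ x = 0) \<longrightarrow> v = 0)" for B
  have "P I" using assms by (auto simp: P_def)
  then obtain B where B: "P B" and max: "\<And>B'. P B' \<Longrightarrow> card B' \<le> card B"
    using ex_has_greatest_nat[of P I card "card (UNIV :: 'e set) + 1"]
    by (auto simp: less_Suc_eq_le card_mono)
  have inj0: "w = 0" if w: "w \<in> row_space A" "\<And>x. x \<in> B \<Longrightarrow> w $ x = 0" for w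
  proof (rule S[OF w(1)])
    fix y assume y: "y \<in> S"
    show "w $ y = 0"
    proof (rule ccontr)
      assume wy: "w $ y \<noteq> 0"
      then have "y \<notin> B" using w(2) by blast
      \<comment> \<open>A kernel vector on \<open>insert y B\<close> is orthogonal to
        \<open>w\<close> and meets its support at most in \<open>y\<close>, so it vanishes at
        \<open>y\<close> and lives on \<open>B\<close>.\<close>
      have "P (insert y B)"
        unfolding P_def
      proof (intro conjI ballI impI)
        fix v assume v: "v \<in> kernel A" "\<forall>x. x \<notin> insert y B \<longrightarrow> v $ x = 0"
        have "0 = v \<bullet> w" using kernel_orthogonal_row_space[OF v(1) w(1)] by simp
        also have "\<dots> = (\<Sum>x\<in>{y}. v $ x * w $ x)"
          unfolding inner_vec_sum by (rule sum.mono_neutral_right) (use v(2) w(2) in auto)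
        finally have "v $ y = 0" using wy by simp
        then show "v = 0" using B v unfolding P_def by (metis insertE)
      qed (use B y in \<open>auto simp: P_def\<close>)
      then have "card (insert y B) \<le> card B" by (rule max)
      then show False using \<open>y \<notin> B\<close> by (simp add: card_insert_if)
    qed
  qed
  have "inj_on (restrict_vec B) (row_space A)"
    unfolding linear_injective_on_subspace_0[OF linear_restrict_vec subspace_row_space]
    using inj0 by (auto simp: restrict_vec_def Finite_Cartesian_Product.vec_eq_iff)
  then have "dim (restrict_vec B ` row_space A) = length A"
    using dim_image_eq[OF linear_restrict_vec, of B "set A"] dim_row_space[OF rank]
    by (simp add: row_space_def linear_span_image[OF linear_restrict_vec, symmetric])
  moreover have "dim (restrict_vec B ` row_space A) \<le> card B"
    unfolding dim_supported[symmetric] by (rule dim_subset) (auto simp: restrict_vec_def)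
  moreover have "\<not> length A < card B"
  proof
    assume "length A < card B"
    then obtain u where "u \<in> kernel A" "u \<noteq> 0" "\<And>x. x \<notin> B \<Longrightarrow> u $ x = 0"
      by (rule kernel_vector_exists) blast
    then show False using B by (auto simp: P_def)
  qed
  ultimately have "card B = length A" by simp
  then have "is_basis A B"
    by (rule is_basisI) (use B in \<open>auto simp: P_def\<close>)
  then show thesis using that B by (auto simp: P_def)
qed

lemma det_submat_basis:
  assumes "totally_unimodular A" "inj_on q {..<length A}"
  shows "Determinant.det (submat A id q (length A)) \<in> {-1, 0, 1}"
  using assms unfolding totally_unimodular_def by (metis id_apply image_id inj_on_id order_refl)

text \<open>Cramer's rule: up to the basis determinant, which is plus or minus one, the entry at
  \<open>b\<close> is the determinant with column \<open>b\<close> exchanged for column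
  \<open>x\<close>.\<close>

lemma fundamental_vector_simple:
  assumes tu: "totally_unimodular A" and "is_basis A B" and v: "v \<in> kernel A"
    and supp: "\<And>y. y \<notin> insert x B \<Longrightarrow> v $ y = 0" and x: "x \<notin> B" "v $ x = -1" and b: "b \<in> B"
  shows "v $ b \<in> {-1, 0, 1}"
proof -
  let ?n = "length A"
  obtain q where q: "bij_betw q {..<?n} B"
    and det: "Determinant.det (submat A id q ?n) \<noteq> 0"
    using assms(2) by (auto simp: is_basis_def)
  have inj: "inj_on q {..<?n}" using q by (auto simp: bij_betw_def)
  obtain k where k: "k < ?n" "q k = b" using q b by (auto simp: bij_betw_def)
  \<comment> \<open>Clearing the entry -1 at \<open>x\<close> leaves a vector supported on
    \<open>B\<close> that solves the linear system whose right-hand side is column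
    \<open>x\<close>.\<close>
  define v' where "v' = v + axis x 1"
  have v': "v' $ y = (if y = x then 0 else v $ y)" for y
    using x by (simp add: v'_def axis_def)
  have "submat A id q ?n *\<^sub>v Matrix.vec ?n (\<lambda>j. v' $ q j) = Matrix.vec ?n (\<lambda>i. (A ! i) \<bullet> v')"
    by (rule submat_mult_vec[OF q]) (use supp in \<open>auto simp: v'\<close>)
  also have "\<dots> = Matrix.vec ?n (\<lambda>i. (A ! i) $ x)"
    using v by (auto simp: v'_def kernel_nth inner_add_right inner_axis)
  finally have "Determinant.det (replace_col (submat A id q ?n) (Matrix.vec ?n (\<lambda>i. (A ! i) $ x)) k)
      = v' $ b * Determinant.det (submat A id q ?n)"
    using cramer_lemma_mat[OF submat_carrier[of A id q ?n], of "Matrix.vec ?n (\<lambda>j. v' $ q j)" k] k by simp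
  moreover have "replace_col (submat A id q ?n) (Matrix.vec ?n (\<lambda>i. (A ! i) $ x)) k
      = submat A id (q(k := x)) ?n"
    by (rule eq_matI) (auto simp: replace_col_def submat_def)
  moreover have "inj_on (q(k := x)) {..<?n}"
    using inj q x(1) by (auto simp: inj_on_def bij_betw_def)
  ultimately have "v' $ b * Determinant.det (submat A id q ?n) \<in> {-1, 0, 1}"
    using det_submat_basis[OF tu] by metis
  moreover have "Determinant.det (submat A id q ?n) \<in> {-1, 1}"
    using det_submat_basis[OF tu inj] det by auto
  moreover have "v' $ b = v $ b" using x b by (auto simp: v')
  ultimately show ?thesis by auto
qed

text \<open>Counting gives a kernel vector on \<open>insert x B\<close>; it cannot vanish at
  \<open>x\<close> because \<open>B\<close> is a basis, so it can be rescaled.\<close>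

lemma fundamental_vector_exists:
  assumes "is_basis A B" "x \<notin> B"
  obtains v where "v \<in> kernel A" "v $ x = -1" "\<And>y. y \<notin> insert x B \<Longrightarrow> v $ y = 0"
proof -
  have "card B = length A"
    using assms(1) bij_betw_same_card by (fastforce simp: is_basis_def)
  then have "length A < card (insert x B)" using assms(2) by (simp add: card_insert_if)
  then obtain u where u: "u \<in> kernel A" "u \<noteq> 0" "\<And>y. y \<notin> insert x B \<Longrightarrow> u $ y = 0"
    by (rule kernel_vector_exists) blast
  have "u $ x \<noteq> 0"
    using basis_kernel_eq_0[OF assms(1) u(1)] u(2,3) by (metis insertE)
  then show thesis
    using u subspace_scale[OF subspace_kernel u(1), of "- 1 / u $ x"]
    by (intro that[of "(- 1 / u $ x) *\<^sub>R u"]) auto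
qed

section \<open>Conformal signed circuits and cocircuits\<close>

text \<open>The elementary vectors of \<open>V\<close>. For the kernel and the row space their
  supports turn out to be circuits and cocircuits.\<close>

definition minimal_support :: "(real^'e) set \<Rightarrow> real^'e \<Rightarrow> bool" where
  "minimal_support V u \<longleftrightarrow> u \<in> V \<and> u \<noteq> 0 \<and>
     (\<forall>u'\<in>V. (\<forall>y. u $ y = 0 \<longrightarrow> u' $ y = 0) \<and> u' \<noteq> 0 \<longrightarrow> (\<forall>y. u' $ y = 0 \<longrightarrow> u $ y = 0))"

text \<open>By minimality no nonzero kernel vector lives on \<open>D\<close>, so \<open>D\<close> is
  independent and extends to a basis.\<close>

lemma minimal_kernel_basis:
  assumes "full_row_rank A" "minimal_support (kernel A) v" "D \<subset> {x. v $ x \<noteq> 0}"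
  obtains B where "is_basis A B" "D \<subseteq> B"
proof (rule basis_between[OF assms(1), of D UNIV])
  fix u assume u: "u \<in> kernel A" "\<And>x. x \<notin> D \<Longrightarrow> u $ x = 0"
  then have "\<forall>y. v $ y = 0 \<longrightarrow> u $ y = 0" using assms(3) by auto
  moreover have "\<not> (\<forall>y. u $ y = 0 \<longrightarrow> v $ y = 0)" using u assms(3) by auto
  ultimately show "u = 0" using assms(2) u(1) by (auto simp: minimal_support_def)
qed (auto simp: Finite_Cartesian_Product.vec_eq_iff intro: that)

lemma minimal_kernel_circuit:
  assumes "full_row_rank A" "minimal_support (kernel A) v"
  shows "is_circuit A {x. v $ x \<noteq> 0}"
  unfolding is_circuit_def
proof (intro conjI allI impI notI)
  assume "\<exists>B. is_basis A B \<and> {x. v $ x \<noteq> 0} \<subseteq> B"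
  then obtain B where B: "is_basis A B" "{x. v $ x \<noteq> 0} \<subseteq> B" by blast
  have "v = 0"
    by (rule basis_kernel_eq_0[OF B(1)]) (use B(2) assms(2) in \<open>auto simp: minimal_support_def\<close>)
  then show False using assms(2) by (simp add: minimal_support_def)
qed (use minimal_kernel_basis[OF assms] in metis)

text \<open>With respect to a basis containing the rest of the support, the multiple of
  \<open>v\<close> with entry -1 at \<open>x\<close> is the fundamental vector of
  \<open>x\<close>.\<close>

lemma minimal_kernel_ratio:
  assumes "full_row_rank A" "totally_unimodular A" "minimal_support (kernel A) v"
    and x: "v $ x \<noteq> 0"
  shows "v $ y / v $ x \<in> {-1, 0, 1}"
proof (cases "y = x \<or> v $ y = 0")
  case False
  obtain B where B: "is_basis A B" "{z. v $ z \<noteq> 0} - {x} \<subseteq> B"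
    using minimal_kernel_basis[OF assms(1,3), of "{z. v $ z \<noteq> 0} - {x}"] x by blast
  have v: "v \<in> kernel A" "v \<noteq> 0" using assms(3) by (auto simp: minimal_support_def)
  have "x \<notin> B"
  proof
    assume "x \<in> B"
    then have "v = 0" by (intro basis_kernel_eq_0[OF B(1) v(1)]) (use B(2) in auto)
    then show False using v(2) by simp
  qed
  have "((- 1 / v $ x) *\<^sub>R v) $ y \<in> {-1, 0, 1}"
    by (rule fundamental_vector_simple[OF assms(2) B(1), where x = x])
      (use x B(2) False \<open>x \<notin> B\<close> subspace_scale[OF subspace_kernel v(1), of "- 1 / v $ x"] in auto)
  then show ?thesis by auto
qed (use x in auto)

text \<open>Minimality makes the complement of \<open>D\<close> spanning, so it contains a
  basis.\<close>

lemma minimal_row_space_basis: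
  assumes "full_row_rank A" "minimal_support (row_space A) w" "D \<subset> {x. w $ x \<noteq> 0}"
  obtains B where "is_basis A B" "D \<inter> B = {}"
proof (rule basis_between[OF assms(1), of "{}" "- D"])
  fix u assume u: "u \<in> row_space A" "\<And>x. x \<in> - D \<Longrightarrow> u $ x = 0"
  then have "\<forall>y. w $ y = 0 \<longrightarrow> u $ y = 0" using assms(3) by auto
  moreover have "\<not> (\<forall>y. u $ y = 0 \<longrightarrow> w $ y = 0)" using u assms(3) by auto
  ultimately show "u = 0" using assms(2) u(1) by (auto simp: minimal_support_def)
qed (use that in \<open>auto simp: Finite_Cartesian_Product.vec_eq_iff\<close>)

lemma minimal_row_space_meets_basis:
  assumes "full_row_rank A" "minimal_support (row_space A) w" "is_basis A B"
  shows "{x. w $ x \<noteq> 0} \<inter> B \<noteq> {}"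
proof
  assume "{x. w $ x \<noteq> 0} \<inter> B = {}"
  then have "w = 0"
    by (intro basis_row_space_eq_0[OF assms(1,3)]) (use assms(2) in \<open>auto simp: minimal_support_def\<close>)
  then show False using assms(2) by (simp add: minimal_support_def)
qed

lemma minimal_row_space_cocircuit:
  assumes "full_row_rank A" "minimal_support (row_space A) w"
  shows "is_cocircuit A {x. w $ x \<noteq> 0}"
  unfolding is_cocircuit_def
  using minimal_row_space_meets_basis[OF assms] minimal_row_space_basis[OF assms] by metis

text \<open>With a basis \<open>B\<close> meeting the support of \<open>w\<close> only in \<open>x\<close>, orthogonality of \<open>w\<close> to the fundamental
  kernel vector of \<open>y\<close> expresses \<open>w y\<close> through \<open>w x\<close>.\<close>

lemma minimal_row_space_ratio:
  assumes "full_row_rank A" "totally_unimodular A" "minimal_support (row_space A) w"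
    and x: "w $ x \<noteq> 0"
  shows "w $ y / w $ x \<in> {-1, 0, 1}"
proof (cases "y = x \<or> w $ y = 0")
  case False
  obtain B where B: "is_basis A B" "({z. w $ z \<noteq> 0} - {x}) \<inter> B = {}"
    using minimal_row_space_basis[OF assms(1,3), of "{z. w $ z \<noteq> 0} - {x}"] x by blast
  have w: "w \<in> row_space A" using assms(3) by (auto simp: minimal_support_def)
  have "x \<in> B" using minimal_row_space_meets_basis[OF assms(1,3) B(1)] B(2) by blast
  have "y \<notin> B" using False B(2) by blast
  obtain v where v: "v \<in> kernel A" "v $ y = -1" "\<And>z. z \<notin> insert y B \<Longrightarrow> v $ z = 0"
    using fundamental_vector_exists[OF B(1) \<open>y \<notin> B\<close>] by blast
  have "0 = v \<bullet> w" using kernel_orthogonal_row_space[OF v(1) w] by simp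
  also have "\<dots> = (\<Sum>z\<in>{x, y}. v $ z * w $ z)"
    unfolding inner_vec_sum by (rule sum.mono_neutral_right) (use v(3) B(2) in auto)
  also have "\<dots> = v $ x * w $ x - w $ y" using False v(2) by (subst sum.insert) auto
  finally have "w $ y / w $ x = v $ x" using x by (simp add: field_simps)
  moreover have "v $ x \<in> {-1, 0, 1}"
    by (rule fundamental_vector_simple[OF assms(2) B(1) v(1) v(3) \<open>y \<notin> B\<close> v(2) \<open>x \<in> B\<close>])
  ultimately show ?thesis by simp
qed (use x in auto)

text \<open>Move from \<open>u\<close> in direction \<open>u'\<close> until the first coordinate
  reaches zero; up to that moment no coordinate changes sign.\<close>

lemma conformal_reduction:
  fixes u u' :: "real^'e::finite"
  assumes "\<And>y. u $ y = 0 \<Longrightarrow> u' $ y = 0" and neg: "u' $ z * u $ z < 0"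
  obtains t y\<^sub>0 where "t > 0" "\<And>y. (u + t *\<^sub>R u') $ y * u $ y \<ge> 0" "u $ y\<^sub>0 \<noteq> 0" "(u + t *\<^sub>R u') $ y\<^sub>0 = 0"
proof -
  define S where "S = {y. u' $ y * u $ y < 0}"
  define r where "r y = - u $ y / u' $ y" for y
  define t where "t = Min (r ` S)"
  have "S \<noteq> {}" using neg by (auto simp: S_def)
  then obtain y\<^sub>0 where y0: "y\<^sub>0 \<in> S" "t = r y\<^sub>0"
    using Min_in[of "r ` S"] unfolding t_def by fastforce
  have t_le: "t \<le> r y" if "y \<in> S" for y using that by (simp add: t_def)
  have "t > 0"
    unfolding y0(2) r_def using y0(1) by (auto simp: S_def mult_less_0_iff divide_less_0_iff)
  moreover have "(u + t *\<^sub>R u') $ y * u $ y \<ge> 0" for y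
  proof (cases "y \<in> S")
    case True
    then have neg: "u' $ y * u $ y < 0" by (simp add: S_def)
    have "t * (- (u' $ y * u $ y)) \<le> r y * (- (u' $ y * u $ y))"
      by (rule mult_right_mono[OF t_le[OF True]]) (use neg in simp)
    also have "\<dots> = u $ y * u $ y" using neg by (auto simp: r_def)
    finally show ?thesis by (simp add: algebra_simps)
  next
    case False
    then have "0 \<le> t * (u' $ y * u $ y)" using \<open>t > 0\<close> by (simp add: S_def)
    moreover have "0 \<le> u $ y * u $ y" by simp
    ultimately show ?thesis by (simp add: algebra_simps)
  qed
  moreover have "u $ y\<^sub>0 \<noteq> 0" "(u + t *\<^sub>R u') $ y\<^sub>0 = 0"
    using y0 by (auto simp: S_def r_def)
  ultimately show thesis by (rule that)
qed

text \<open>Among the vectors of \<open>V\<close> that are nonzero at \<open>x\<close> and conformal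
  to \<open>v\<close>, one with smallest support is elementary: a vector of smaller support inside
  it could be used to cancel a coordinate, or would, up to sign, be a better candidate
  itself.\<close>

lemma conformal_minimal_support:
  fixes v :: "real^'e::finite"
  assumes V: "subspace V" "v \<in> V" and x: "v $ x \<noteq> 0"
  obtains u where "minimal_support V u" "u $ x \<noteq> 0" "\<And>y. u $ y \<noteq> 0 \<Longrightarrow> u $ y * v $ y > 0"
proof -
  define P where "P u \<longleftrightarrow> u \<in> V \<and> u $ x \<noteq> 0 \<and> (\<forall>y. u $ y \<noteq> 0 \<longrightarrow> u $ y * v $ y > 0)" for u
  define c where "c u = card {y. u $ y \<noteq> 0}" for u :: "real^'e"
  have "P v" using assms by (auto simp: P_def zero_less_mult_iff)
  then obtain u where u: "P u" and least: "\<And>w. P w \<Longrightarrow> c u \<le> c w"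
    using ex_has_least_nat[of P v c] by auto
  have "minimal_support V u"
    unfolding minimal_support_def
  proof (intro conjI ballI impI)
    fix u\<^sub>0 assume u0: "u\<^sub>0 \<in> V" "(\<forall>y. u $ y = 0 \<longrightarrow> u\<^sub>0 $ y = 0) \<and> u\<^sub>0 \<noteq> 0"
    show "\<forall>y. u\<^sub>0 $ y = 0 \<longrightarrow> u $ y = 0"
    proof (rule ccontr)
      assume "\<not> (\<forall>y. u\<^sub>0 $ y = 0 \<longrightarrow> u $ y = 0)"
      then have small: "c u\<^sub>0 < c u"
        unfolding c_def by (intro psubset_card_mono) (use u0(2) in auto)
      \<comment> \<open>A vector that opposes \<open>u\<close> somewhere but not at \<open>x\<close>
        can be added to \<open>u\<close> until a coordinate vanishes. The entry at \<open>x\<close>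
        survives, so the result is a smaller candidate.\<close>
      have no_neg: False if u': "u' \<in> V" "\<And>y. u $ y = 0 \<Longrightarrow> u' $ y = 0"
        and x_ge: "u' $ x * u $ x \<ge> 0" and neg: "u' $ z * u $ z < 0" for u' z
      proof -
        obtain t y\<^sub>0 where t: "t > 0" "\<And>y. (u + t *\<^sub>R u') $ y * u $ y \<ge> 0"
          "u $ y\<^sub>0 \<noteq> 0" "(u + t *\<^sub>R u') $ y\<^sub>0 = 0"
          using conformal_reduction[OF u'(2) neg] by blast
        define w where "w = u + t *\<^sub>R u'"
        have w_supp: "w $ y = 0" if "u $ y = 0" for y using that u'(2) by (simp add: w_def)
        have "w $ x * u $ x = u $ x * u $ x + t * (u' $ x * u $ x)"
          by (simp add: w_def algebra_simps)
        moreover have "0 < u $ x * u $ x" using u by (auto simp: P_def zero_less_mult_iff)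
        moreover have "0 \<le> t * (u' $ x * u $ x)" using x_ge t(1) by simp
        ultimately have "w $ x \<noteq> 0" by auto
        moreover have "w $ y * v $ y > 0" if "w $ y \<noteq> 0" for y
        proof -
          have "u $ y \<noteq> 0" using that w_supp by blast
          then have "u $ y * v $ y > 0" "w $ y * u $ y > 0"
            using u t(2)[of y] that by (auto simp: P_def w_def[symmetric] less_le)
          then show ?thesis by (auto simp: zero_less_mult_iff)
        qed
        moreover have "w \<in> V"
          using u u'(1) V(1) by (auto simp: w_def P_def intro: subspace_add subspace_scale)
        ultimately have "P w" by (simp add: P_def)
        moreover have "c w < c u"
          unfolding c_def by (intro psubset_card_mono) (use w_supp t(3,4) in \<open>auto simp: w_def\<close>)
        ultimately show False using least by fastforce
      qed
      obtain z where z: "u\<^sub>0 $ z \<noteq> 0" "u $ z \<noteq> 0"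
        using u0(2) by (metis Finite_Cartesian_Product.vec_eq_iff zero_index)
      \<comment> \<open>The sign makes \<open>u'\<close> not oppose \<open>u\<close> at
        \<open>x\<close>; if \<open>u'\<close> vanishes at \<open>x\<close>, the sign makes it
        oppose \<open>u\<close> at \<open>z\<close>, which \<open>no_neg\<close> excludes.\<close>
      define u' where "u' = (if u\<^sub>0 $ x * u $ x < 0 \<or> u\<^sub>0 $ x = 0 \<and> u\<^sub>0 $ z * u $ z > 0 then - u\<^sub>0 else u\<^sub>0)"
      have u': "u' \<in> V" "\<And>y. u' $ y = 0 \<longleftrightarrow> u\<^sub>0 $ y = 0" "u' $ x * u $ x \<ge> 0"
        "u\<^sub>0 $ x = 0 \<Longrightarrow> u' $ z * u $ z < 0"
        using u0(1) V(1) z by (auto simp: u'_def subspace_neg not_less less_le)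
      have nonneg: "u' $ y * u $ y \<ge> 0" for y
        using no_neg[OF u'(1) _ u'(3)] u0(2) u'(2) by (meson not_le)
      have "P u'"
        unfolding P_def
      proof (intro conjI allI impI)
        show "u' $ x \<noteq> 0" using nonneg[of z] u'(2,4) by force
        fix y assume y: "u' $ y \<noteq> 0"
        then have "u $ y \<noteq> 0" using u'(2) u0(2) by blast
        then have "u' $ y * u $ y > 0" "u $ y * v $ y > 0"
          using nonneg[of y] y u by (auto simp: P_def less_le)
        then show "u' $ y * v $ y > 0" by (auto simp: zero_less_mult_iff)
      qed (rule u'(1))
      then have "c u \<le> c u'" by (rule least)
      moreover have "c u' = c u\<^sub>0" by (simp add: c_def u'(2))
      ultimately show False using small by simp
    qed
  qed (use u in \<open>auto simp: P_def\<close>)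
  then show thesis using that u by (auto simp: P_def)
qed

section \<open>Signed circuits and cocircuits from elementary vectors\<close>

definition sign_chain :: "real^'e \<Rightarrow> 'e chain" where
  "sign_chain u = (\<chi> y. if u $ y > 0 then 1 else if u $ y < 0 then -1 else 0)"

text \<open>All nonzero entries have the same absolute value, so taking signs is a positive
  rescaling and does not leave the kernel or row space.\<close>

lemma sign_chain:
  fixes u :: "real^'e::finite"
  assumes x: "u $ x \<noteq> 0" and ratio: "\<And>y. u $ y / u $ x \<in> {-1, 0, 1}"
  shows "real_chain (sign_chain u) = (1 / \<bar>u $ x\<bar>) *\<^sub>R u"
proof -
  have "real_of_int (sign_chain u $ y) = u $ y / \<bar>u $ x\<bar>" for y
  proof -
    have "u $ y = - u $ x \<or> u $ y = 0 \<or> u $ y = u $ x"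
      using ratio[of y] x by (auto simp: field_simps)
    then show ?thesis using x by (auto simp: sign_chain_def)
  qed
  then show ?thesis by (simp add: real_chain_def Finite_Cartesian_Product.vec_eq_iff)
qed

lemma supp_sign_chain: "supp (sign_chain u) = {x. u $ x \<noteq> 0}"
  by (auto simp: supp_def sign_chain_def)

lemma simple_sign_chain: "simple_chain (sign_chain u)"
  by (auto simp: simple_chain_def sign_chain_def)

definition conformal :: "'e::finite chain \<Rightarrow> real^'e \<Rightarrow> bool" where
  "conformal C v \<longleftrightarrow> (\<forall>y\<in>supp C. real_of_int (C $ y) * v $ y > 0)"

lemma conformal_sign_chain:
  assumes "\<And>y. u $ y \<noteq> 0 \<Longrightarrow> u $ y * v $ y > 0"
  shows "conformal (sign_chain u) v"
  unfolding conformal_def supp_sign_chain using assms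
  by (force simp: sign_chain_def zero_less_mult_iff)

lemma conformal_signed_circuit:
  assumes "full_row_rank A" "totally_unimodular A" "v \<in> kernel A" "v $ x \<noteq> 0"
  obtains C where "signed_circuit A C" "x \<in> supp C" "conformal C v"
proof -
  obtain u where u: "minimal_support (kernel A) u" "u $ x \<noteq> 0" "\<And>y. u $ y \<noteq> 0 \<Longrightarrow> u $ y * v $ y > 0"
    using conformal_minimal_support[OF subspace_kernel assms(3,4)] by blast
  have "real_chain (sign_chain u) \<in> kernel A"
    unfolding sign_chain[OF u(2) minimal_kernel_ratio[OF assms(1,2) u(1,2)]]
    using u(1) by (intro subspace_scale subspace_kernel) (simp add: minimal_support_def)
  then have "signed_circuit A (sign_chain u)"
    using minimal_kernel_circuit[OF assms(1) u(1)]
    by (simp add: signed_circuit_def supp_sign_chain simple_sign_chain)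
  then show thesis
    using that[of "sign_chain u"] u(2) conformal_sign_chain[OF u(3)] by (simp add: supp_sign_chain)
qed

lemma conformal_signed_cocircuit:
  assumes "full_row_rank A" "totally_unimodular A" "v \<in> row_space A" "v $ x \<noteq> 0"
  obtains C where "signed_cocircuit A C" "x \<in> supp C" "conformal C v"
proof -
  obtain u where u: "minimal_support (row_space A) u" "u $ x \<noteq> 0" "\<And>y. u $ y \<noteq> 0 \<Longrightarrow> u $ y * v $ y > 0"
    using conformal_minimal_support[OF subspace_row_space assms(3,4)] by blast
  have "real_chain (sign_chain u) \<in> row_space A"
    unfolding sign_chain[OF u(2) minimal_row_space_ratio[OF assms(1,2) u(1,2)]]
    using u(1) by (intro subspace_scale subspace_row_space) (simp add: minimal_support_def)
  then have "signed_cocircuit A (sign_chain u)"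
    using minimal_row_space_cocircuit[OF assms(1) u(1)]
    by (simp add: signed_cocircuit_def supp_sign_chain simple_sign_chain)
  then show thesis
    using that[of "sign_chain u"] u(2) conformal_sign_chain[OF u(3)] by (simp add: supp_sign_chain)
qed

text \<open>Vector form of Minty's colouring lemma. The cone \<open>H\<close> either contains the
  signed axis of \<open>x\<close>, which exhibits a row space vector, or is separated from it by a
  hyperplane whose normal is, up to sign, a kernel vector.\<close>

lemma farkas_alternative:
  fixes A :: "'e::finite row_matrix" and s :: "'e \<Rightarrow> real"
  assumes s: "\<And>y. s y \<noteq> 0"
  obtains v where "v \<in> kernel A \<or> v \<in> row_space A" "v $ x \<noteq> 0" "\<And>y. s y * v $ y \<ge> 0"
proof -
  define G where "G = set A \<union> uminus ` set A \<union> (\<lambda>y. axis y (- s y)) ` (- {x})"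
  define H where "H = convex_cone hull G"
  have "finite G" by (simp add: G_def)
  then have closed: "closed H" unfolding H_def by (rule closed_convex_cone_hull)
  have G_H: "g \<in> H" if "g \<in> G" for g using that by (simp add: H_def hull_inc)
  show thesis
  proof (cases "axis x (s x) \<in> H")
    case True
    \<comment> \<open>Vectors dominated by a row space vector, with equality at \<open>x\<close>.
      They form a convex cone containing the generators of \<open>H\<close>, so a row space vector
      can be read off from \<open>axis x (s x)\<close>.\<close>
    define K where "K = {z. \<exists>w\<in>row_space A. w $ x = z $ x \<and> (\<forall>y. y \<noteq> x \<longrightarrow> s y * w $ y \<ge> s y * z $ y)}"
    have "convex_cone K"
      unfolding convex_cone_iff
    proof (intro conjI ballI allI impI)
      show "0 \<in> K" unfolding K_def using subspace_0[OF subspace_row_space, of A] by (intro CollectI bexI[of _ 0]) auto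
    next
      fix a b assume "a \<in> K" "b \<in> K"
      then obtain wa wb where w: "wa \<in> row_space A" "wb \<in> row_space A" "wa $ x = a $ x" "wb $ x = b $ x"
        "\<forall>y. y \<noteq> x \<longrightarrow> s y * wa $ y \<ge> s y * a $ y" "\<forall>y. y \<noteq> x \<longrightarrow> s y * wb $ y \<ge> s y * b $ y"
        unfolding K_def by blast
      then show "a + b \<in> K"
        unfolding K_def using subspace_add[OF subspace_row_space w(1,2)]
        by (intro CollectI bexI[of _ "wa + wb"]) (auto simp: distrib_left intro: add_mono)
    next
      fix a and c :: real assume "a \<in> K" "0 \<le> c"
      then obtain w where w: "w \<in> row_space A" "w $ x = a $ x" "\<forall>y. y \<noteq> x \<longrightarrow> s y * w $ y \<ge> s y * a $ y"
        unfolding K_def by blast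
      have "s y * (c * w $ y) \<ge> s y * (c * a $ y)" if "y \<noteq> x" for y
        using mult_left_mono[OF w(3)[rule_format, OF that] \<open>0 \<le> c\<close>] by (simp add: mult.left_commute)
      then show "c *\<^sub>R a \<in> K"
        unfolding K_def using w(2) subspace_scale[OF subspace_row_space w(1), of c]
        by (intro CollectI bexI[of _ "c *\<^sub>R w"]) auto
    qed
    moreover have "G \<subseteq> K"
    proof
      fix g assume "g \<in> G"
      then consider "g \<in> row_space A" | y where "y \<noteq> x" "g = axis y (- s y)"
        by (auto simp: G_def row_space_def span_base span_neg)
      then show "g \<in> K"
      proof cases
        case 1
        then show ?thesis by (auto simp: K_def)
      next
        case 2
        then show ?thesis
          unfolding K_def by (intro CollectI bexI[of _ 0]) (auto simp: axis_def subspace_0 subspace_row_space)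
      qed
    qed
    ultimately have "H \<subseteq> K" unfolding H_def by (metis hull_minimal)
    then obtain w where w: "w \<in> row_space A" "w $ x = s x" "\<forall>y. y \<noteq> x \<longrightarrow> s y * w $ y \<ge> 0"
      using True by (auto simp: K_def axis_def)
    have "s y * w $ y \<ge> 0" for y using w(2,3) by (cases "y = x") auto
    then show thesis using w(1,2) s[of x] by (intro that[of w]) auto
  next
    case False
    obtain a b where ab: "a \<bullet> axis x (s x) < b" "\<forall>z\<in>H. a \<bullet> z > b"
      using separating_hyperplane_closed_point[OF _ closed False]
      unfolding H_def using convex_convex_cone_hull by blast
    have "b < 0" using ab(2) convex_cone_hull_contains_0 unfolding H_def by force
    \<comment> \<open>A point of the cone with negative value could be scaled to have value exactly
      \<open>b\<close>, against strict separation.\<close>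
    have nonneg: "a \<bullet> z \<ge> 0" if "z \<in> H" for z
    proof (rule ccontr)
      assume neg: "\<not> a \<bullet> z \<ge> 0"
      then have "(b / (a \<bullet> z)) *\<^sub>R z \<in> H"
        using that \<open>b < 0\<close> unfolding H_def by (intro convex_cone_hull_mul) (auto simp: divide_simps)
      then show False using ab(2) neg by force
    qed
    have "r \<bullet> a = 0" if "r \<in> set A" for r
      using nonneg[OF G_H, of r] nonneg[OF G_H, of "- r"] that by (auto simp: G_def inner_commute)
    then have "- a \<in> kernel A" by (simp add: kernel_def)
    moreover have "(- a) $ x \<noteq> 0" using ab(1) \<open>b < 0\<close> by (auto simp: inner_axis)
    moreover have "s y * (- a) $ y \<ge> 0" for y
    proof (cases "y = x")
      case True
      then show ?thesis using ab(1) \<open>b < 0\<close> by (simp add: inner_axis mult.commute)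
    next
      case False
      then show ?thesis
        using nonneg[OF G_H, of "axis y (- s y)"] by (auto simp: G_def inner_axis mult.commute)
    qed
    ultimately show thesis using that by blast
  qed
qed

section \<open>Cycle and cut chains\<close>

lemma real_chain_nth [simp]: "real_chain a $ x = real_of_int (a $ x)"
  by (simp add: real_chain_def)

lemma real_chain_zero [simp]: "real_chain 0 = 0"
  and real_chain_add [simp]: "real_chain (a + b) = real_chain a + real_chain b"
  and real_chain_diff [simp]: "real_chain (a - b) = real_chain a - real_chain b"
  and real_chain_minus [simp]: "real_chain (- a) = - real_chain a"
  by (simp_all add: Finite_Cartesian_Product.vec_eq_iff)

text \<open>All integral kernel vectors, rather than the lattice generated by the signed circuits:
  membership is then a linear condition. The generated lattice is contained in it by
  \<open>circuit_lattice_subset\<close>.\<close>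

definition cycle_chains :: "'e::finite row_matrix \<Rightarrow> 'e chain set" where
  "cycle_chains A = {a. real_chain a \<in> kernel A}"

definition cut_chains :: "'e::finite row_matrix \<Rightarrow> 'e chain set" where
  "cut_chains A = {b. real_chain b \<in> row_space A}"

definition cycle_cut_chains :: "'e::finite row_matrix \<Rightarrow> 'e chain set" where
  "cycle_cut_chains A = {a + b | a b. a \<in> cycle_chains A \<and> b \<in> cut_chains A}"

definition signed_cycle_or_cut :: "'e::finite row_matrix \<Rightarrow> 'e chain \<Rightarrow> bool" where
  "signed_cycle_or_cut A C \<longleftrightarrow> signed_circuit A C \<or> signed_cocircuit A C"

text \<open>\<open>C\<close> is a piece of \<open>a\<close>: subtracting it erases the entries of
  \<open>a\<close> on the support of \<open>C\<close>, so pieces can be peeled off one by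
  one.\<close>

definition restricts :: "'e::finite chain \<Rightarrow> 'e chain \<Rightarrow> bool" where
  "restricts C a \<longleftrightarrow> (\<forall>y\<in>supp C. C $ y = a $ y)"

lemma cycle_chains_closed:
  "0 \<in> cycle_chains A" "a \<in> cycle_chains A \<Longrightarrow> b \<in> cycle_chains A \<Longrightarrow> a + b \<in> cycle_chains A"
  "a \<in> cycle_chains A \<Longrightarrow> b \<in> cycle_chains A \<Longrightarrow> a - b \<in> cycle_chains A"
  "a \<in> cycle_chains A \<Longrightarrow> - a \<in> cycle_chains A"
  by (auto simp: cycle_chains_def subspace_0 subspace_add subspace_diff subspace_neg subspace_kernel)

lemma cut_chains_closed:
  "0 \<in> cut_chains A" "a \<in> cut_chains A \<Longrightarrow> b \<in> cut_chains A \<Longrightarrow> a + b \<in> cut_chains A"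
  "a \<in> cut_chains A \<Longrightarrow> b \<in> cut_chains A \<Longrightarrow> a - b \<in> cut_chains A"
  "a \<in> cut_chains A \<Longrightarrow> - a \<in> cut_chains A"
  by (auto simp: cut_chains_def subspace_0 subspace_add subspace_diff subspace_neg subspace_row_space)

lemma cycle_subset: "cycle_chains A \<subseteq> cycle_cut_chains A"
  and cut_subset: "cut_chains A \<subseteq> cycle_cut_chains A"
  unfolding cycle_cut_chains_def using cycle_chains_closed(1) cut_chains_closed(1)
  by (force, force)

lemma cycle_cut_chains_add:
  assumes "d \<in> cycle_cut_chains A" "e \<in> cycle_cut_chains A"
  shows "d + e \<in> cycle_cut_chains A"
proof -
  obtain a b a' b' where "a \<in> cycle_chains A" "b \<in> cut_chains A" "d = a + b"
    "a' \<in> cycle_chains A" "b' \<in> cut_chains A" "e = a' + b'"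
    using assms by (auto simp: cycle_cut_chains_def)
  moreover have "(a + b) + (a' + b') = (a + a') + (b + b')" by (simp add: algebra_simps)
  ultimately show ?thesis
    unfolding cycle_cut_chains_def using cycle_chains_closed(2) cut_chains_closed(2) by blast
qed

lemma cycle_cut_chains_minus:
  assumes "d \<in> cycle_cut_chains A"
  shows "- d \<in> cycle_cut_chains A"
proof -
  obtain a b where "a \<in> cycle_chains A" "b \<in> cut_chains A" "d = a + b"
    using assms by (auto simp: cycle_cut_chains_def)
  moreover have "- (a + b) = (- a) + (- b)" by simp
  ultimately show ?thesis
    unfolding cycle_cut_chains_def using cycle_chains_closed(4) cut_chains_closed(4) by blast
qed

lemma cycle_cut_chains_diff:
  "d \<in> cycle_cut_chains A \<Longrightarrow> e \<in> cycle_cut_chains A \<Longrightarrow> d - e \<in> cycle_cut_chains A"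
  using cycle_cut_chains_add[of d A "- e"] cycle_cut_chains_minus[of e A] by simp

lemma signed_circuit_cycle: "signed_circuit A C \<Longrightarrow> C \<in> cycle_chains A"
  by (simp add: signed_circuit_def cycle_chains_def)

lemma signed_cocircuit_cut: "signed_cocircuit A C \<Longrightarrow> C \<in> cut_chains A"
  by (simp add: signed_cocircuit_def cut_chains_def)

lemma signed_cycle_or_cut_chain: "signed_cycle_or_cut A C \<Longrightarrow> C \<in> cycle_cut_chains A"
  using signed_circuit_cycle signed_cocircuit_cut cycle_subset cut_subset
  unfolding signed_cycle_or_cut_def by blast

lemma signed_cycle_or_cut_simple: "signed_cycle_or_cut A C \<Longrightarrow> simple_chain C"
  by (auto simp: signed_cycle_or_cut_def signed_circuit_def signed_cocircuit_def)

lemma supp_minus [simp]: "supp (- C) = supp C"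
  by (simp add: supp_def)

lemma simple_chain_minus [simp]: "simple_chain (- C) \<longleftrightarrow> simple_chain C"
  unfolding simple_chain_def by (metis (no_types, lifting) vector_uminus_component
      add.inverse_inverse insert_iff minus_zero singletonD)

lemma signed_circuit_minus: "signed_circuit A C \<Longrightarrow> signed_circuit A (- C)"
  by (auto simp: signed_circuit_def subspace_neg subspace_kernel)

lemma signed_cocircuit_minus: "signed_cocircuit A C \<Longrightarrow> signed_cocircuit A (- C)"
  by (auto simp: signed_cocircuit_def subspace_neg subspace_row_space)

lemma signed_cycle_or_cut_minus: "signed_cycle_or_cut A C \<Longrightarrow> signed_cycle_or_cut A (- C)"
  using signed_circuit_minus signed_cocircuit_minus by (auto simp: signed_cycle_or_cut_def)

section \<open>Orthogonality and splitting of simple chains\<close>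

lemma chain_orthogonal:
  assumes "a \<in> cycle_chains A" "b \<in> cut_chains A"
  shows "(\<Sum>x\<in>UNIV. a $ x * b $ x) = 0"
proof -
  have "real_of_int (\<Sum>x\<in>UNIV. a $ x * b $ x) = real_chain a \<bullet> real_chain b"
    by (simp add: inner_vec_sum)
  also have "\<dots> = 0"
    using kernel_orthogonal_row_space assms by (auto simp: cycle_chains_def cut_chains_def)
  finally show ?thesis by linarith
qed

lemma mult_nonpos_of_small_sum:
  fixes a b :: int
  assumes "\<bar>a + b\<bar> \<le> 1"
  shows "a * b \<le> 0"
  using assms by (auto simp: mult_le_0_iff)

lemma simple_chain_iff: "simple_chain a \<longleftrightarrow> (\<forall>x. \<bar>a $ x\<bar> \<le> 1)"
proof -
  have "\<bar>n\<bar> \<le> 1 \<longleftrightarrow> n \<in> {-1, 0, 1}" for n :: int by auto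
  then show ?thesis unfolding simple_chain_def by blast
qed

text \<open>Nonzero entries of equal sign would add up to at least 2 in absolute value, so every
  product is nonpositive; by orthogonality the products sum to zero.\<close>

lemma simple_sum_disjoint:
  assumes "a \<in> cycle_chains A" "b \<in> cut_chains A" "simple_chain (a + b)"
  shows "a $ x * b $ x = 0"
proof -
  have "(\<Sum>x\<in>UNIV. - (a $ x * b $ x)) = 0"
    using chain_orthogonal[OF assms(1,2)] by (simp add: sum_negf)
  moreover have "- (a $ x * b $ x) \<ge> 0" for x
    using mult_nonpos_of_small_sum[of "a $ x" "b $ x"] assms(3) by (simp add: simple_chain_iff)
  ultimately show ?thesis
    using sum_nonneg_eq_0_iff[of UNIV "\<lambda>x. - (a $ x * b $ x)"] by simp
qed

lemma conformal_value:
  assumes "simple_chain C" "conformal C (real_chain a)" "y \<in> supp C" "\<bar>a $ y\<bar> \<le> 1"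
  shows "C $ y = a $ y"
proof -
  have "real_of_int (C $ y * a $ y) > 0" using assms(2,3) by (simp add: conformal_def)
  then have "C $ y * a $ y > 0" by linarith
  moreover have "\<bar>C $ y\<bar> \<le> 1" using assms(1) by (simp add: simple_chain_iff)
  ultimately show ?thesis using assms(4) by (auto simp: zero_less_mult_iff)
qed

lemma cycle_restricts:
  assumes "full_row_rank A" "totally_unimodular A" "a \<in> cycle_chains A" "simple_chain a" "x \<in> supp a"
  obtains C where "signed_circuit A C" "x \<in> supp C" "restricts C a"
proof -
  obtain C where C: "signed_circuit A C" "x \<in> supp C" "conformal C (real_chain a)"
    by (rule conformal_signed_circuit[OF assms(1,2), of "real_chain a" x])
      (use assms(3,5) in \<open>auto simp: cycle_chains_def supp_def\<close>)
  then have "restricts C a"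
    using conformal_value assms(4) by (auto simp: restricts_def signed_circuit_def simple_chain_iff)
  then show thesis using that C by blast
qed

lemma cut_restricts:
  assumes "full_row_rank A" "totally_unimodular A" "a \<in> cut_chains A" "simple_chain a" "x \<in> supp a"
  obtains C where "signed_cocircuit A C" "x \<in> supp C" "restricts C a"
proof -
  obtain C where C: "signed_cocircuit A C" "x \<in> supp C" "conformal C (real_chain a)"
    by (rule conformal_signed_cocircuit[OF assms(1,2), of "real_chain a" x])
      (use assms(3,5) in \<open>auto simp: cut_chains_def supp_def\<close>)
  then have "restricts C a"
    using conformal_value assms(4) by (auto simp: restricts_def signed_cocircuit_def simple_chain_iff)
  then show thesis using that C by blast
qed

text \<open>The cycle part and the cut part have disjoint supports, so both are simple and a piece
  of either one is a piece of \<open>d\<close>.\<close>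

lemma cycle_cut_restricts:
  assumes "full_row_rank A" "totally_unimodular A" "d \<in> cycle_cut_chains A" "simple_chain d" "x \<in> supp d"
  obtains C where "signed_cycle_or_cut A C" "x \<in> supp C" "restricts C d"
proof -
  obtain a b where ab: "a \<in> cycle_chains A" "b \<in> cut_chains A" "d = a + b"
    using assms(3) by (auto simp: cycle_cut_chains_def)
  have disj: "a $ y = 0 \<or> b $ y = 0" for y
    using simple_sum_disjoint[OF ab(1,2), of y] assms(4) ab(3) by simp
  have simple: "simple_chain a" "simple_chain b"
    unfolding simple_chain_iff
  proof (safe)
    fix y
    have "\<bar>a $ y + b $ y\<bar> \<le> 1" using assms(4) ab(3) by (simp add: simple_chain_iff)
    then show "\<bar>a $ y\<bar> \<le> 1" "\<bar>b $ y\<bar> \<le> 1" using disj[of y] by auto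
  qed
  have "x \<in> supp a \<or> x \<in> supp b" using assms(5) ab(3) by (auto simp: supp_def)
  then show thesis
  proof
    assume "x \<in> supp a"
    then obtain C where C: "signed_circuit A C" "x \<in> supp C" "restricts C a"
      using cycle_restricts[OF assms(1,2) ab(1) simple(1)] by blast
    then have "restricts C d" using disj ab(3) by (force simp: restricts_def supp_def)
    then show thesis using that C by (auto simp: signed_cycle_or_cut_def)
  next
    assume "x \<in> supp b"
    then obtain C where C: "signed_cocircuit A C" "x \<in> supp C" "restricts C b"
      using cut_restricts[OF assms(1,2) ab(2) simple(2)] by blast
    then have "restricts C d" using disj ab(3) by (force simp: restricts_def supp_def)
    then show thesis using that C by (auto simp: signed_cycle_or_cut_def)
  qed
qed

text \<open>Indecomposability: once a piece \<open>C\<close> is peeled off, a nonzero remainder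
  would contain a second piece disjoint from \<open>C\<close>, although both pass through
  \<open>g\<close>. The abstract \<open>L\<close> and \<open>S\<close> cover cycles, cuts and their
  sums.\<close>

lemma restricts_all_imp_eq:
  assumes diff: "\<And>a b. \<lbrakk>a \<in> L; b \<in> L\<rbrakk> \<Longrightarrow> a - b \<in> L"
    and S: "\<And>C. S C \<Longrightarrow> C \<in> L"
    and dec: "\<And>a x. \<lbrakk>a \<in> L; simple_chain a; x \<in> supp a\<rbrakk> \<Longrightarrow> \<exists>C. S C \<and> x \<in> supp C \<and> restricts C a"
    and a: "a \<in> L" "simple_chain a" "x \<in> supp a"
    and g: "\<And>C y. \<lbrakk>S C; y \<in> supp C; restricts C a\<rbrakk> \<Longrightarrow> g \<in> supp C"
  shows "S a"
proof -
  obtain C where C: "S C" "x \<in> supp C" "restricts C a" using dec[OF a] by blast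
  have diff_val: "(a - C) $ y = (if y \<in> supp C then 0 else a $ y)" for y
    using C(3) by (auto simp: restricts_def supp_def)
  have "a - C = 0"
  proof (rule ccontr)
    assume "a - C \<noteq> 0"
    then obtain y where y: "y \<in> supp (a - C)" by (auto simp: supp_def Finite_Cartesian_Product.vec_eq_iff)
    have "simple_chain (a - C)" unfolding simple_chain_iff diff_val using a(2) by (simp add: simple_chain_iff)
    then obtain C' where C': "S C'" "y \<in> supp C'" "restricts C' (a - C)"
      using dec[OF diff[OF a(1) S[OF C(1)]] _ y] by blast
    then have eq: "C' $ z = a $ z \<and> z \<notin> supp C" if "z \<in> supp C'" for z
      using that diff_val[of z] by (auto simp: restricts_def supp_def split: if_splits)
    then have "restricts C' a" by (simp add: restricts_def)
    then have "g \<in> supp C'" using g C'(1,2) by blast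
    moreover have "g \<in> supp C" using g C by blast
    ultimately show False using eq by blast
  qed
  then show ?thesis using C(1) by simp
qed

section \<open>Orientations and the canonical action\<close>

text \<open>Values 0 and 1, instead of -1 and 1, make the reversal of \<open>C\<close> subtract
  \<open>C\<close> and not twice \<open>C\<close>.\<close>

definition orient_chain :: "'e::finite orientation \<Rightarrow> 'e chain" where
  "orient_chain Q = (\<chi> x. if Q x = Plus then 1 else 0)"

lemma orient_chain_nth: "orient_chain Q $ x = (if Q x = Plus then 1 else 0)"
  by (simp add: orient_chain_def)

lemma agrees_iff: "agrees C Q \<longleftrightarrow> (\<forall>x\<in>supp C. C $ x > 0 \<longleftrightarrow> Q x = Plus)"
proof -
  have "chain_sign C x = Q x \<longleftrightarrow> (C $ x > 0 \<longleftrightarrow> Q x = Plus)" for x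
    by (cases "Q x") (auto simp: chain_sign_def)
  then show ?thesis by (simp add: agrees_def)
qed

lemma opposite_iff: "opposite s = Plus \<longleftrightarrow> s \<noteq> Plus"
  by (cases s) auto

lemma orient_chain_inj: "orient_chain Q = orient_chain Q' \<Longrightarrow> Q = Q'"
proof
  fix x assume "orient_chain Q = orient_chain Q'"
  then have "orient_chain Q $ x = orient_chain Q' $ x" by simp
  then show "Q x = Q' x"
    by (cases "Q x"; cases "Q' x") (auto simp: orient_chain_nth)
qed

lemma simple_cases: "simple_chain C \<Longrightarrow> C $ x = -1 \<or> C $ x = 0 \<or> C $ x = 1"
  by (auto simp: simple_chain_def)

lemma simple_orient_diff: "simple_chain (orient_chain Q - orient_chain Q')"
  by (simp add: simple_chain_iff orient_chain_nth)

lemma orient_chain_reverse: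
  assumes "simple_chain C" "agrees C Q"
  shows "orient_chain (reverse_on (supp C) Q) = orient_chain Q - C"
proof -
  have "orient_chain (reverse_on (supp C) Q) $ x = (orient_chain Q - C) $ x" for x
    using simple_cases[OF assms(1), of x] assms(2)
    by (auto simp: orient_chain_nth reverse_on_def agrees_iff supp_def opposite_iff)
  then show ?thesis by (simp add: Finite_Cartesian_Product.vec_eq_iff)
qed

text \<open>The difference is nonzero exactly where the orientations disagree, and there it has the
  sign of \<open>Q\<close>.\<close>

lemma restricts_orient_diff:
  assumes "restricts C (orient_chain Q - orient_chain Q')"
  shows "agrees C Q" "agrees (- C) Q'"
proof -
  have "C $ y \<noteq> 0" "C $ y = (if Q y = Plus then 1 else 0) - (if Q' y = Plus then 1 else 0)"
    if "y \<in> supp C" for y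
    using assms that by (auto simp: restricts_def supp_def orient_chain_nth)
  then show "agrees C Q" "agrees (- C) Q'"
    unfolding agrees_iff by (auto split: if_splits; force)+
qed

lemma reverse_on_twice: "reverse_on X (reverse_on X Q) = Q"
proof
  fix x show "reverse_on X (reverse_on X Q) x = Q x"
    by (cases "Q x") (auto simp: reverse_on_def)
qed

lemma agrees_minus_reverse: "agrees C Q \<Longrightarrow> agrees (- C) (reverse_on (supp C) Q)"
  by (auto simp: agrees_iff reverse_on_def supp_def opposite_iff)

lemma reversal_step_chain:
  assumes "reversal_step A Q Q'"
  shows "orient_chain Q - orient_chain Q' \<in> cycle_cut_chains A"
proof -
  obtain C where "signed_cycle_or_cut A C" "agrees C Q" "Q' = reverse_on (supp C) Q"
    using assms by (auto simp: reversal_step_def signed_cycle_or_cut_def)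
  then show ?thesis
    using orient_chain_reverse[OF signed_cycle_or_cut_simple] signed_cycle_or_cut_chain by force
qed

lemma equivclp_chain:
  assumes "equivclp (reversal_step A) Q Q'"
  shows "orient_chain Q - orient_chain Q' \<in> cycle_cut_chains A"
  using assms
proof (induction rule: equivclp_induct)
  case base
  show ?case using cycle_subset cycle_chains_closed(1) by auto
next
  case (step y z)
  then have "orient_chain y - orient_chain z \<in> cycle_cut_chains A"
    using reversal_step_chain cycle_cut_chains_minus by (metis minus_diff_eq)
  then show ?case using cycle_cut_chains_add[OF step.IH] by fastforce
qed

text \<open>Induction on the number of disagreements: a piece of the difference is compatible with
  \<open>Q\<close>, and reversing it creates agreement with \<open>Q'\<close> on its
  support.\<close>

lemma chain_equivclp:
  assumes "full_row_rank A" "totally_unimodular A"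
    and "orient_chain Q - orient_chain Q' \<in> cycle_cut_chains A"
  shows "equivclp (reversal_step A) Q Q'"
  using assms(3)
proof (induction "card {x. Q x \<noteq> Q' x}" arbitrary: Q rule: less_induct)
  case less
  show ?case
  proof (cases "Q = Q'")
    case False
    then have "orient_chain Q - orient_chain Q' \<noteq> 0" using orient_chain_inj by auto
    then obtain x where x: "x \<in> supp (orient_chain Q - orient_chain Q')"
      by (auto simp: supp_def Finite_Cartesian_Product.vec_eq_iff)
    obtain C where C: "signed_cycle_or_cut A C" "x \<in> supp C" "restricts C (orient_chain Q - orient_chain Q')"
      using cycle_cut_restricts[OF assms(1,2) less.prems simple_orient_diff x] .
    note agr = restricts_orient_diff[OF C(3)]
    define R where "R = reverse_on (supp C) Q"
    have step: "reversal_step A Q R"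
      using C(1) agr(1) by (auto simp: reversal_step_def signed_cycle_or_cut_def R_def)
    have R: "R y = Q' y" if y: "y \<in> supp C" for y
    proof -
      have "C $ y \<noteq> 0" "C $ y > 0 \<longleftrightarrow> Q y = Plus" "- C $ y > 0 \<longleftrightarrow> Q' y = Plus"
        using y agr by (auto simp: agrees_iff supp_def)
      then show ?thesis using y by (cases "Q y"; cases "Q' y") (auto simp: R_def reverse_on_def)
    qed
    have "R y = Q y" if "y \<notin> supp C" for y using that by (simp add: R_def reverse_on_def)
    then have "{y. R y \<noteq> Q' y} \<subset> {y. Q y \<noteq> Q' y}"
      using R x C(2) by (force simp: supp_def orient_chain_nth)
    then have "card {y. R y \<noteq> Q' y} < card {y. Q y \<noteq> Q' y}" by (simp add: psubset_card_mono)
    moreover have "orient_chain R - orient_chain Q' = orient_chain Q - orient_chain Q' - C"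
      using orient_chain_reverse[OF signed_cycle_or_cut_simple[OF C(1)] agr(1)] by (simp add: R_def)
    then have "orient_chain R - orient_chain Q' \<in> cycle_cut_chains A"
      using cycle_cut_chains_diff[OF less.prems signed_cycle_or_cut_chain[OF C(1)]] by (simp only:)
    ultimately have "equivclp (reversal_step A) R Q'" by (rule less.hyps)
    then show ?thesis using r_into_equivclp[of "reversal_step A", OF step] by (blast intro: equivclp_trans)
  qed simp
qed

lemma orientation_class_eq_iff:
  assumes "full_row_rank A" "totally_unimodular A"
  shows "orientation_class A Q = orientation_class A Q'
    \<longleftrightarrow> orient_chain Q - orient_chain Q' \<in> cycle_cut_chains A"
proof
  assume "orientation_class A Q = orientation_class A Q'"
  then have "Q' \<in> orientation_class A Q" by (simp add: orientation_class_def)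
  then show "orient_chain Q - orient_chain Q' \<in> cycle_cut_chains A"
    by (simp add: orientation_class_def equivclp_chain)
next
  assume "orient_chain Q - orient_chain Q' \<in> cycle_cut_chains A"
  then have "equivclp (reversal_step A) Q Q'" by (rule chain_equivclp[OF assms])
  then show "orientation_class A Q = orientation_class A Q'"
    unfolding orientation_class_def by (blast intro: equivclp_sym equivclp_trans)
qed

lemma orientation_class_mem:
  "Q' \<in> orientation_class A Q \<Longrightarrow> orient_chain Q - orient_chain Q' \<in> cycle_cut_chains A"
  by (simp add: orientation_class_def equivclp_chain)

text \<open>Apply \<open>farkas_alternative\<close> to the signs of \<open>Q\<close>; a conformal
  signed circuit or cocircuit through \<open>x\<close> inherits these signs.\<close>

lemma agreeing_cycle_or_cut:
  assumes "full_row_rank A" "totally_unimodular A"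
  obtains C where "signed_cycle_or_cut A C" "x \<in> supp C" "agrees C Q"
proof -
  define s :: "'a \<Rightarrow> real" where "s y = (if Q y = Plus then 1 else -1)" for y
  obtain v where v: "v \<in> kernel A \<or> v \<in> row_space A" "v $ x \<noteq> 0" "\<And>y. s y * v $ y \<ge> 0"
    by (rule farkas_alternative[of s A x]) (auto simp: s_def)
  obtain C where C: "signed_cycle_or_cut A C" "x \<in> supp C" "conformal C v"
    using v(1) conformal_signed_circuit[OF assms _ v(2)] conformal_signed_cocircuit[OF assms _ v(2)]
    unfolding signed_cycle_or_cut_def by metis
  have "C $ y > 0 \<longleftrightarrow> Q y = Plus" if y: "y \<in> supp C" for y
    using C(3)[unfolded conformal_def, rule_format, OF y] v(3)[of y]
    by (auto simp: s_def zero_less_mult_iff split: if_splits)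
  then show thesis using that C by (simp add: agrees_iff)
qed

lemma arcE:
  assumes "is_arc F"
  obtains f where "supp F = {f}" "F $ f = 1 \<or> F $ f = -1"
  using assms by (auto simp: is_arc_def supp_def simple_chain_def)

text \<open>Resolves the choice in \<open>arc_action\<close>. If \<open>f\<close> points the wrong
  way, reversing a compatible circuit or cocircuit through \<open>f\<close> turns it, so a
  representative exists; whichever one is chosen, its chain is known modulo
  \<open>cycle_cut_chains A\<close>.\<close>

lemma arc_action_chain:
  assumes "full_row_rank A" "totally_unimodular A" "is_arc F"
  obtains Q' where "arc_action A F (orientation_class A Q) = orientation_class A Q'"
    "orient_chain Q' - orient_chain Q - F \<in> cycle_cut_chains A"
proof -
  define G where "G = orientation_class A Q"
  have "\<exists>R. R \<in> G \<and> agrees (- F) R"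
  proof (cases "agrees (- F) Q")
    case True
    then show ?thesis by (intro exI[of _ Q]) (auto simp: G_def orientation_class_def)
  next
    case False
    obtain f where f: "supp F = {f}" "F $ f = 1 \<or> F $ f = -1" by (rule arcE[OF assms(3)])
    obtain C where C: "signed_cycle_or_cut A C" "f \<in> supp C" "agrees C Q"
      by (rule agreeing_cycle_or_cut[OF assms(1,2), of f Q])
    then have "reversal_step A Q (reverse_on (supp C) Q)"
      by (auto simp: reversal_step_def signed_cycle_or_cut_def)
    moreover have "agrees (- F) (reverse_on (supp C) Q)"
      using False C(2) f by (auto simp: agrees_iff reverse_on_def opposite_iff)
    ultimately show ?thesis
      unfolding G_def orientation_class_def by (metis mem_Collect_eq r_into_equivclp)
  qed
  then obtain R where R: "R = (SOME R. R \<in> G \<and> agrees (- F) R)" "R \<in> G" "agrees (- F) R"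
    by (metis (mono_tags, lifting) someI_ex)
  have "orient_chain (reverse_on (supp F) R) = orient_chain R + F"
    using orient_chain_reverse[of "- F" R] R(3) assms(3) by (simp add: is_arc_def)
  moreover have "orient_chain R - orient_chain Q \<in> cycle_cut_chains A"
    using orientation_class_mem R(2) cycle_cut_chains_minus unfolding G_def by (metis minus_diff_eq)
  ultimately have "orient_chain (reverse_on (supp F) R) - orient_chain Q - F \<in> cycle_cut_chains A"
    by simp
  moreover have "arc_action A F G = orientation_class A (reverse_on (supp F) R)"
    by (simp add: arc_action_def R(1))
  ultimately show thesis using that by (simp add: G_def)
qed

lemma fold_arc_action_chain:
  assumes "full_row_rank A" "totally_unimodular A" "\<forall>F\<in>set Fs. is_arc F"
  shows "\<exists>Q'. fold (arc_action A) Fs (orientation_class A Q) = orientation_class A Q'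
    \<and> orient_chain Q' - orient_chain Q - sum_list Fs \<in> cycle_cut_chains A"
  using assms(3)
proof (induction Fs arbitrary: Q)
  case Nil
  show ?case using cycle_subset cycle_chains_closed(1) by (intro exI[of _ Q]) auto
next
  case (Cons F Fs)
  obtain R where R: "arc_action A F (orientation_class A Q) = orientation_class A R"
    "orient_chain R - orient_chain Q - F \<in> cycle_cut_chains A"
    by (rule arc_action_chain[OF assms(1,2), of F Q]) (use Cons.prems in auto)
  obtain Q' where Q': "fold (arc_action A) Fs (orientation_class A R) = orientation_class A Q'"
    "orient_chain Q' - orient_chain R - sum_list Fs \<in> cycle_cut_chains A"
    using Cons.IH Cons.prems by (meson list.set_intros(2))
  have "orient_chain Q' - orient_chain Q - sum_list (F # Fs) \<in> cycle_cut_chains A"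
    using cycle_cut_chains_add[OF R(2) Q'(2)] by (simp add: algebra_simps)
  then show ?case using R(1) Q'(1) by auto
qed

section \<open>The sandpile lattice and the action of its classes\<close>

lemma group_chain_group: "group (chain_group :: 'e::finite chain monoid)"
proof (rule groupI)
  fix x :: "'e chain"
  show "\<exists>y\<in>carrier chain_group. y \<otimes>\<^bsub>chain_group\<^esub> x = \<one>\<^bsub>chain_group\<^esub>"
    by (intro bexI[of _ "- x"]) (auto simp: chain_group_def)
qed (auto simp: chain_group_def algebra_simps)

lemma chain_group_simps:
  "carrier chain_group = UNIV" "x \<otimes>\<^bsub>chain_group\<^esub> y = x + y" "\<one>\<^bsub>chain_group\<^esub> = 0"
  by (simp_all add: chain_group_def)

lemma inv_chain_group: "inv\<^bsub>chain_group\<^esub> x = - x"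
  by (rule group.inv_equality[OF group_chain_group]) (auto simp: chain_group_def)

lemma circuit_lattice_subset: "circuit_lattice A \<subseteq> cycle_chains A"
proof
  fix x assume "x \<in> circuit_lattice A"
  then show "x \<in> cycle_chains A"
    unfolding circuit_lattice_def
    by (induction rule: generate.induct)
      (auto simp: inv_chain_group chain_group_simps signed_circuit_cycle cycle_chains_closed)
qed

lemma cocircuit_lattice_subset: "cocircuit_lattice A \<subseteq> cut_chains A"
proof
  fix x assume "x \<in> cocircuit_lattice A"
  then show "x \<in> cut_chains A"
    unfolding cocircuit_lattice_def
    by (induction rule: generate.induct)
      (auto simp: inv_chain_group chain_group_simps signed_cocircuit_cut cut_chains_closed)
qed

lemma sandpile_lattice_subset: "sandpile_lattice A \<subseteq> cycle_cut_chains A"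
  using circuit_lattice_subset cocircuit_lattice_subset
  unfolding sandpile_lattice_def set_mult_def cycle_cut_chains_def
  by (fastforce simp: chain_group_def)

lemma zero_in_sandpile_lattice: "0 \<in> sandpile_lattice A"
proof -
  have "0 \<in> circuit_lattice A" "0 \<in> cocircuit_lattice A"
    unfolding circuit_lattice_def cocircuit_lattice_def
    using generate.one[of chain_group] by (simp_all add: chain_group_def)
  then show ?thesis
    unfolding sandpile_lattice_def set_mult_def by (force simp: chain_group_def)
qed

lemma sandpile_class_eq:
  assumes "sandpile_class A P = sandpile_class A P'"
  shows "P - P' \<in> cycle_cut_chains A"
proof -
  have "P \<in> sandpile_class A P"
    using zero_in_sandpile_lattice by (force simp: sandpile_class_def r_coset_def chain_group_def)
  then have "P \<in> sandpile_class A P'" using assms by simp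
  then obtain h where "h \<in> sandpile_lattice A" "P = h + P'"
    by (auto simp: sandpile_class_def r_coset_def chain_group_def)
  then show ?thesis using sandpile_lattice_subset by auto
qed

text \<open>Resolves the definite description in \<open>canonical_action\<close>: the list
  \<open>[F]\<close> provides a value, and any other admissible list of arcs ends in the same class,
  because chains modulo \<open>cycle_cut_chains A\<close> determine classes.\<close>

lemma canonical_action_chain:
  assumes "full_row_rank A" "totally_unimodular A" "is_arc F"
  obtains Q' where "canonical_action A (sandpile_class A F) (orientation_class A Q) = orientation_class A Q'"
    "orient_chain Q' - orient_chain Q - F \<in> cycle_cut_chains A"
proof -
  define P where "P G' \<longleftrightarrow> (\<exists>Fs. (\<forall>F\<in>set Fs. is_arc F) \<and> sandpile_class A (sum_list Fs) = sandpile_class A F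
      \<and> G' = fold (arc_action A) Fs (orientation_class A Q))" for G'
  obtain Q' where Q': "arc_action A F (orientation_class A Q) = orientation_class A Q'"
    "orient_chain Q' - orient_chain Q - F \<in> cycle_cut_chains A"
    using arc_action_chain[OF assms] .
  have "P (orientation_class A Q')"
    unfolding P_def using assms(3) Q'(1) by (intro exI[of _ "[F]"]) auto
  moreover have "G' = orientation_class A Q'" if P: "P G'" for G'
  proof -
    obtain Fs where Fs: "\<forall>F\<in>set Fs. is_arc F" "sandpile_class A (sum_list Fs) = sandpile_class A F"
      "G' = fold (arc_action A) Fs (orientation_class A Q)"
      using P unfolding P_def by blast
    obtain R where R: "G' = orientation_class A R"
      "orient_chain R - orient_chain Q - sum_list Fs \<in> cycle_cut_chains A"
      using fold_arc_action_chain[OF assms(1,2) Fs(1)] Fs(3) by blast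
    have "orient_chain R - orient_chain Q' \<in> cycle_cut_chains A"
      using cycle_cut_chains_diff[OF cycle_cut_chains_add[OF R(2) sandpile_class_eq[OF Fs(2)]] Q'(2)]
      by (simp add: algebra_simps)
    then show ?thesis using R(1) orientation_class_eq_iff[OF assms(1,2)] by blast
  qed
  ultimately have "(THE G'. P G') = orientation_class A Q'" by (rule the_equality)
  then show thesis
    using that Q'(2) by (simp add: canonical_action_def P_def)
qed

lemma orientation_action_chain:
  assumes "full_row_rank A" "totally_unimodular A" "is_arc F"
    and "orientation_action A \<sigma> \<sigma>' (sandpile_class A F) Q = Some Q'"
  shows "orient_chain Q' - orient_chain Q - F \<in> cycle_cut_chains A"
proof -
  obtain R where R: "canonical_action A (sandpile_class A F) (orientation_class A Q) = orientation_class A R"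
    "orient_chain R - orient_chain Q - F \<in> cycle_cut_chains A"
    using canonical_action_chain[OF assms(1-3)] .
  have "compatible_rep A \<sigma> \<sigma>' (orientation_class A R) = Some Q'"
    using assms(4) R(1) by (simp add: orientation_action_def)
  then have ex1: "\<exists>!Q. Q \<in> orientation_class A R \<and> compatible_orientation A \<sigma> \<sigma>' Q"
    and the: "Q' = (THE Q. Q \<in> orientation_class A R \<and> compatible_orientation A \<sigma> \<sigma>' Q)"
    by (auto simp: compatible_rep_def split: if_splits)
  have "Q' \<in> orientation_class A R" unfolding the using theI'[OF ex1] by blast
  then show ?thesis
    using cycle_cut_chains_diff[OF R(2) orientation_class_mem[of Q' A R]] by (simp add: algebra_simps)
qed

section \<open>Compatible orientations\<close>

text \<open>Both \<open>C\<close> and \<open>- C\<close> would be the value of one signature on the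
  same support.\<close>

lemma compatible_no_opposite:
  assumes "compatible_orientation A \<sigma> \<sigma>' Q" "compatible_orientation A \<sigma> \<sigma>' Q'"
    and C: "signed_cycle_or_cut A C" "supp C \<noteq> {}" "agrees C Q" "agrees (- C) Q'"
  shows False
proof -
  have "\<exists>\<tau>. in_signature C \<tau> \<and> in_signature (- C) \<tau>"
    using assms signed_circuit_minus signed_cocircuit_minus
    unfolding compatible_orientation_def signed_cycle_or_cut_def by blast
  then have "C = - C" by (metis in_signature_def supp_minus)
  then have "C $ x = - C $ x" for x by (metis uminus_vec_def vector_uminus_component)
  then have "C $ x = 0" for x by (metis equal_neg_zero)
  then show False using C(2) by (auto simp: supp_def)
qed

section \<open>Recovering the reversals from the chains\<close>

lemma reverse_agreeing_eq:
  assumes "simple_chain C" "agrees C Q" "orient_chain Q' = orient_chain Q - C"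
  shows "Q' = reverse_on (supp C) Q"
  by (rule orient_chain_inj) (simp add: assms orient_chain_reverse)

text \<open>A piece of the remaining difference that avoids \<open>f\<close> would already be
  compatible with \<open>Q\<^sub>1\<close>, against \<open>compatible_no_opposite\<close>. Hence all
  pieces pass through \<open>f\<close>, and a nonzero difference is a single signed circuit or
  cocircuit.\<close>

lemma flip_then_reverse:
  assumes "full_row_rank A" "totally_unimodular A"
    and compat: "compatible_orientation A \<sigma> \<sigma>' Q\<^sub>1" "compatible_orientation A \<sigma> \<sigma>' Q\<^sub>2"
    and mem: "orient_chain (reverse_on {f} Q\<^sub>1) - orient_chain Q\<^sub>2 \<in> cycle_cut_chains A"
  obtains "Q\<^sub>2 = reverse_on {f} Q\<^sub>1"
  | C where "signed_cycle_or_cut A C" "f \<in> supp C" "agrees C (reverse_on {f} Q\<^sub>1)"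
    "Q\<^sub>2 = reverse_on (supp C) (reverse_on {f} Q\<^sub>1)"
proof -
  define R where "R = reverse_on {f} Q\<^sub>1"
  define d where "d = orient_chain R - orient_chain Q\<^sub>2"
  show thesis
  proof (cases "d = 0")
    case True
    then show ?thesis using that(1) orient_chain_inj by (auto simp: d_def R_def)
  next
    case False
    then obtain x where x: "x \<in> supp d" by (auto simp: supp_def Finite_Cartesian_Product.vec_eq_iff)
    have simple: "simple_chain d" unfolding d_def by (rule simple_orient_diff)
    have f: "f \<in> supp C" if C: "signed_cycle_or_cut A C" "y \<in> supp C" "restricts C d" for C y
    proof (rule ccontr)
      assume nf: "f \<notin> supp C"
      have agr: "agrees C R" "agrees (- C) Q\<^sub>2"
        using restricts_orient_diff C(3) by (auto simp: d_def)
      have "agrees C Q\<^sub>1" using agr(1) nf by (auto simp: agrees_iff R_def reverse_on_def)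
      then show False using compatible_no_opposite[OF compat C(1) _ _ agr(2)] C(2) by blast
    qed
    have "signed_cycle_or_cut A d"
    proof (rule restricts_all_imp_eq[where L = "cycle_cut_chains A" and g = f and x = x])
      show "\<exists>C. signed_cycle_or_cut A C \<and> x \<in> supp C \<and> restricts C a"
        if "a \<in> cycle_cut_chains A" "simple_chain a" "x \<in> supp a" for a x
        using cycle_cut_restricts[OF assms(1,2) that] by blast
    qed (use mem simple x f in \<open>auto simp: d_def R_def intro: cycle_cut_chains_diff signed_cycle_or_cut_chain\<close>)
    moreover have "restricts d (orient_chain R - orient_chain Q\<^sub>2)" by (simp add: restricts_def d_def)
    then have agr: "agrees d R" by (rule restricts_orient_diff)
    moreover have "Q\<^sub>2 = reverse_on (supp d) R"
      by (rule reverse_agreeing_eq[OF simple agr]) (simp add: d_def)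
    moreover have "f \<in> supp d" using f[OF calculation(1) x] by (simp add: restricts_def)
    ultimately show ?thesis using that(2) by (simp add: R_def)
  qed
qed

lemma int_sum_eq_1:
  fixes t :: "'a \<Rightarrow> int"
  assumes "finite S" "\<And>x. x \<in> S \<Longrightarrow> t x \<ge> 0" "sum t S = 1"
  obtains g where "g \<in> S" "t g = 1" "\<And>x. \<lbrakk>x \<in> S; x \<noteq> g\<rbrakk> \<Longrightarrow> t x = 0"
proof -
  have "\<exists>g\<in>S. t g \<noteq> 0" using assms(3) by (metis sum.neutral zero_neq_one)
  then obtain g where g: "g \<in> S" "t g \<noteq> 0" by blast
  have "sum t S = t g + sum t (S - {g})" using assms(1) g(1) by (rule sum.remove)
  moreover have "sum t (S - {g}) \<ge> 0" using assms(2) by (intro sum_nonneg) auto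
  ultimately have "t g = 1" "sum t (S - {g}) = 0" using assms(2)[OF g(1)] g(2) assms(3) by linarith+
  then show thesis
    using that[of g] g(1) sum_nonneg_eq_0_iff[of "S - {g}" t] assms(1,2) by auto
qed

text \<open>\<open>X\<close> and \<open>Y\<close> are the circuit and the cocircuit in either order;
  \<open>X\<close>, reversed first, is the one whose sign at \<open>g\<close> is that of
  \<open>Q\<^sub>1\<close>.\<close>

lemma two_reversals:
  assumes X: "simple_chain X" and Y: "simple_chain Y"
    and inter: "supp X \<inter> supp Y = {f, g}" "g \<noteq> f"
    and F: "supp F = {f}" "X $ f = F $ f" "Y $ f = F $ f" and g: "X $ g = - Y $ g"
    and sum: "orient_chain Q\<^sub>1 - orient_chain Q\<^sub>2 + F = X + Y"
    and sign: "X $ g > 0 \<longleftrightarrow> Q\<^sub>1 g = Plus" "agrees F Q\<^sub>1"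
  shows "agrees X Q\<^sub>1" "agrees Y (reverse_on {f} (reverse_on (supp X) Q\<^sub>1))"
    "Q\<^sub>2 = reverse_on (supp Y) (reverse_on {f} (reverse_on (supp X) Q\<^sub>1))"
    "Q\<^sub>2 = reverse_on ((supp X \<union> supp Y) - {g}) Q\<^sub>1"
proof -
  let ?R = "reverse_on {f} (reverse_on (supp X) Q\<^sub>1)"
  have F0: "F $ x = 0" if "x \<noteq> f" for x using F(1) that by (auto simp: supp_def)
  \<comment> \<open>Away from \<open>f\<close> and \<open>g\<close> at most one of \<open>X\<close>
    and \<open>Y\<close> is nonzero, and its entry is then the difference of the two
    orientations.\<close>
  have val: "(if Q\<^sub>1 x = Plus then 1 else 0) - (if Q\<^sub>2 x = Plus then 1 else 0) + F $ x = X $ x + Y $ x" for x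
    using arg_cong[OF sum, of "\<lambda>c. c $ x"] by (simp add: orient_chain_nth)
  have fX: "f \<in> supp X" "f \<in> supp Y" "g \<in> supp X" "g \<in> supp Y" using inter by auto
  have disj: "x \<notin> supp X \<or> x \<notin> supp Y" if "x \<noteq> f" "x \<noteq> g" for x using inter that by blast
  have Ff: "F $ f > 0 \<longleftrightarrow> Q\<^sub>1 f = Plus" using sign(2) F(1) by (simp add: agrees_iff)
  show agrX: "agrees X Q\<^sub>1"
    unfolding agrees_iff
  proof
    fix x assume x: "x \<in> supp X"
    consider "x = f" | "x = g" | "x \<noteq> f" "x \<noteq> g" by blast
    then show "X $ x > 0 \<longleftrightarrow> Q\<^sub>1 x = Plus"
    proof cases
      case 3
      then show ?thesis using val[of x] F0[of x] disj[of x] x by (auto simp: supp_def split: if_splits)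
    qed (use F(2) Ff sign(1) in auto)
  qed
  \<comment> \<open>Of the elements shared with \<open>X\<close>, reversing \<open>X\<close> and
    then \<open>f\<close> restores \<open>f\<close> and flips \<open>g\<close>.\<close>
  show agrY: "agrees Y ?R"
    unfolding agrees_iff
  proof
    fix x assume x: "x \<in> supp Y"
    consider "x = f" | "x = g" | "x \<noteq> f" "x \<noteq> g" by blast
    then show "Y $ x > 0 \<longleftrightarrow> ?R x = Plus"
    proof cases
      case 1
      then show ?thesis using F(3) Ff fX by (simp add: reverse_on_def opposite_iff)
    next
      case 2
      then have "?R x = Plus \<longleftrightarrow> Q\<^sub>1 g \<noteq> Plus" using inter(2) fX by (simp add: reverse_on_def opposite_iff)
      then show ?thesis using 2 g sign(1) fX(4) by (auto simp: supp_def)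
    next
      case 3
      then have "?R x = Q\<^sub>1 x" using disj x by (auto simp: reverse_on_def)
      then show ?thesis using 3 val[of x] F0[of x] disj[of x] x by (auto simp: supp_def split: if_splits)
    qed
  qed
  have "agrees (- F) (reverse_on (supp X) Q\<^sub>1)"
    using Ff fX(1) F(1) by (auto simp: agrees_iff reverse_on_def opposite_iff supp_def)
  moreover have "simple_chain (- F)"
    unfolding simple_chain_iff
  proof
    fix x show "\<bar>(- F) $ x\<bar> \<le> 1"
      using X[unfolded simple_chain_iff, rule_format, of f] F(2) F0[of x] by (cases "x = f") auto
  qed
  ultimately have "orient_chain ?R = orient_chain Q\<^sub>1 - X + F"
    using orient_chain_reverse[of "- F"] orient_chain_reverse[OF X agrX] F(1) by simp
  then show Q2: "Q\<^sub>2 = reverse_on (supp Y) ?R"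
    using sum by (intro reverse_agreeing_eq[OF Y agrY]) (simp add: algebra_simps)
  have opp: "opposite (opposite s) = s" for s by (cases s) auto
  \<comment> \<open>In total \<open>f\<close> is flipped three times, \<open>g\<close> twice and
    every other element at most once.\<close>
  show "Q\<^sub>2 = reverse_on ((supp X \<union> supp Y) - {g}) Q\<^sub>1"
  proof
    fix x
    show "Q\<^sub>2 x = reverse_on ((supp X \<union> supp Y) - {g}) Q\<^sub>1 x"
      unfolding Q2 using disj[of x] fX inter(2) by (auto simp: reverse_on_def opp)
  qed
qed

text \<open>At \<open>f\<close> the cycle part \<open>a\<close> and the cut part \<open>b\<close> add up to \<open>\<plusminus>2\<close>, elsewhere
  to at most \<open>1\<close> in absolute value. By orthogonality either one of them carries the whole \<open>\<plusminus>2\<close>, which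
  contradicts compatibility, or both are \<open>\<plusminus>1\<close> at \<open>f\<close> and cancel at exactly one other element \<open>g\<close>.\<close>

lemma opposite_arc_cycle_and_cut:
  assumes rank: "full_row_rank A" "totally_unimodular A"
    and arc: "is_arc F" "supp F = {f}"
    and compat: "compatible_orientation A \<sigma> \<sigma>' Q\<^sub>1" "compatible_orientation A \<sigma> \<sigma>' Q\<^sub>2"
    and mem: "orient_chain Q\<^sub>1 - orient_chain Q\<^sub>2 + F \<in> cycle_cut_chains A"
    and agr: "agrees F Q\<^sub>1" "agrees (- F) Q\<^sub>2"
  obtains C D g where "signed_circuit A C" "signed_cocircuit A D"
    "orient_chain Q\<^sub>1 - orient_chain Q\<^sub>2 + F = C + D" "g \<noteq> f" "supp C \<inter> supp D = {f, g}"
    "C $ f = F $ f" "D $ f = F $ f" "C $ g = - D $ g"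
proof -
  define d where "d = orient_chain Q\<^sub>1 - orient_chain Q\<^sub>2"
  obtain a b where ab: "a \<in> cycle_chains A" "b \<in> cut_chains A" "d + F = a + b"
    using mem by (auto simp: cycle_cut_chains_def d_def)
  have Ff: "F $ f = 1 \<or> F $ f = -1"
    using arc(2) simple_cases[of F f] arc(1) by (auto simp: is_arc_def supp_def)
  have F0: "F $ x = 0" if "x \<noteq> f" for x using arc(2) that by (auto simp: supp_def)
  have df: "d $ f = F $ f"
    using agr arc(2) Ff by (auto simp: agrees_iff d_def orient_chain_nth)
  have sum_f: "a $ f + b $ f = 2 * F $ f" using arg_cong[OF ab(3), of "\<lambda>c. c $ f"] df by simp
  have sum_x: "a $ x + b $ x = d $ x" if "x \<noteq> f" for x
    using arg_cong[OF ab(3), of "\<lambda>c. c $ x"] F0[OF that] by simp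
  have d_le: "\<bar>d $ x\<bar> \<le> 1" for x
    using simple_orient_diff unfolding d_def simple_chain_iff by blast
  have no_restrict: "\<not> restricts C d" if "signed_cycle_or_cut A C" "x \<in> supp C" for C x
    using compatible_no_opposite[OF compat that(1)] restricts_orient_diff that(2) unfolding d_def by blast
  have prod_le: "- (a $ x * b $ x) \<ge> 0" if "x \<noteq> f" for x
    using mult_nonpos_of_small_sum[of "a $ x" "b $ x"] sum_x[OF that] d_le[of x] by simp
  have sum_prod: "(\<Sum>x\<in>- {f}. - (a $ x * b $ x)) = a $ f * b $ f"
    using chain_orthogonal[OF ab(1,2)] sum.remove[of UNIV f "\<lambda>x. a $ x * b $ x"]
    by (simp add: sum_negf Compl_eq_Diff_UNIV)
  have prod_f: "a $ f * b $ f \<ge> 0"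
    unfolding sum_prod[symmetric] using prod_le by (intro sum_nonneg) auto
  \<comment> \<open>Integers with nonnegative product and sum plus or minus 2 split only in these
    ways.\<close>
  have C_f: "a $ f = 0 \<and> b $ f = 2 * F $ f \<or> a $ f = 2 * F $ f \<and> b $ f = 0 \<or> a $ f = F $ f \<and> b $ f = F $ f"
  proof -
    have "a $ f \<in> {0, F $ f, 2 * F $ f}"
      using prod_f sum_f Ff by (auto simp: zero_le_mult_iff)
    then show ?thesis using sum_f by auto
  qed
  have not_all: "a $ f = F $ f \<and> b $ f = F $ f"
  proof (rule ccontr)
    assume neg: "\<not> ?thesis"
    then have "a $ f * b $ f = 0" using C_f by auto
    then have disj: "a $ x * b $ x = 0" for x
      using sum_nonneg_eq_0_iff[of "- {f}" "\<lambda>x. - (a $ x * b $ x)"] sum_prod prod_le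
      by (cases "x = f") auto
    \<comment> \<open>Entries of \<open>C\<close> are at most 1 in absolute value, so at
      \<open>f\<close> it has the value \<open>d $ f\<close> although \<open>e\<close> has absolute
      value 2 there; elsewhere disjointness of \<open>a\<close> and \<open>b\<close> gives the value
      of \<open>d\<close>.\<close>
    have C_eq_d: "C $ y = d $ y" if "simple_chain C" "conformal C (real_chain e)" "y \<in> supp C"
      and "e = a \<or> e = b" for C e y
    proof (cases "y = f")
      case True
      have "real_of_int (C $ y * e $ y) > 0" using that(2,3) by (simp add: conformal_def)
      then have "C $ y * e $ y > 0" by linarith
      then show ?thesis
        using True simple_cases[OF that(1), of y] C_f neg df that(4) Ff by (auto simp: zero_less_mult_iff)
    next
      case False
      have "e $ y \<noteq> 0" using that(2,3) by (auto simp: conformal_def)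
      then have "e $ y = d $ y" using that(4) sum_x[OF False] disj[of y] by auto
      then show ?thesis using conformal_value[OF that(1-3)] d_le[of y] by simp
    qed
    have "a $ f \<noteq> 0 \<or> b $ f \<noteq> 0" using C_f Ff by auto
    then show False
    proof
      assume "a $ f \<noteq> 0"
      then obtain C where C: "signed_circuit A C" "f \<in> supp C" "conformal C (real_chain a)"
        using conformal_signed_circuit[OF rank, of "real_chain a" f] ab(1) by (auto simp: cycle_chains_def)
      have "restricts C d"
        unfolding restricts_def using C_eq_d[OF _ C(3)] C(1) by (auto simp: signed_circuit_def)
      then show False using no_restrict C by (auto simp: signed_cycle_or_cut_def)
    next
      assume "b $ f \<noteq> 0"
      then obtain C where C: "signed_cocircuit A C" "f \<in> supp C" "conformal C (real_chain b)"
        using conformal_signed_cocircuit[OF rank, of "real_chain b" f] ab(2) by (auto simp: cut_chains_def)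
      have "restricts C d"
        unfolding restricts_def using C_eq_d[OF _ C(3)] C(1) by (auto simp: signed_cocircuit_def)
      then show False using no_restrict C by (auto simp: signed_cycle_or_cut_def)
    qed
  qed
  then have "(\<Sum>x\<in>- {f}. - (a $ x * b $ x)) = 1" unfolding sum_prod using Ff by auto
  then obtain g where g: "g \<noteq> f" "- (a $ g * b $ g) = 1"
    and others: "\<And>x. \<lbrakk>x \<noteq> f; x \<noteq> g\<rbrakk> \<Longrightarrow> a $ x * b $ x = 0"
    using int_sum_eq_1[of "- {f}" "\<lambda>x. - (a $ x * b $ x)"] prod_le by auto
  have ag: "a $ g = 1 \<and> b $ g = -1 \<or> a $ g = -1 \<and> b $ g = 1"
    using g(2) zmult_eq_1_iff[of "a $ g" "- b $ g"] by auto
  \<comment> \<open>Where one part is nonzero the other vanishes, except at \<open>g\<close> and at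
    \<open>f\<close>; at \<open>f\<close> each part equals \<open>F $ f\<close>, which is
    \<open>d $ f\<close>.\<close>
  have val: "e $ y = d $ y" if "e = a \<or> e = b" "y \<noteq> g" "e $ y \<noteq> 0" for e y
    using that others[of y] sum_x[of y] not_all df by (cases "y = f") auto
  have simple: "simple_chain e" if "e = a \<or> e = b" for e
    unfolding simple_chain_iff
  proof
    fix y
    consider "y = g" | "y \<noteq> g" "e $ y = 0" | "y \<noteq> g" "e $ y \<noteq> 0" by blast
    then show "\<bar>e $ y\<bar> \<le> 1"
    proof cases
      case 3
      then show ?thesis using val[OF that, of y] d_le[of y] by simp
    qed (use ag that in auto)
  qed
  \<comment> \<open>A piece of \<open>a\<close> or \<open>b\<close> avoiding \<open>g\<close> would
    be a piece of \<open>d\<close>, which \<open>no_restrict\<close> forbids. This makes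
    \<open>a\<close> and \<open>b\<close> indecomposable.\<close>
  have through_g: "g \<in> supp C"
    if "signed_cycle_or_cut A C" "y \<in> supp C" "restricts C e" "e = a \<or> e = b" for C e y
  proof (rule ccontr)
    assume g: "g \<notin> supp C"
    have "C $ z = d $ z" if z: "z \<in> supp C" for z
    proof -
      have "C $ z = e $ z" using \<open>restricts C e\<close> z by (simp add: restricts_def)
      moreover have "z \<noteq> g" "C $ z \<noteq> 0" using z g by (auto simp: supp_def)
      ultimately show ?thesis using val[OF \<open>e = a \<or> e = b\<close>, of z] by simp
    qed
    then have "restricts C d" by (simp add: restricts_def)
    then show False using no_restrict that(1,2) by blast
  qed
  have f_supp: "f \<in> supp a" "f \<in> supp b" using not_all Ff by (auto simp: supp_def)
  have a: "signed_circuit A a"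
  proof (rule restricts_all_imp_eq[where L = "cycle_chains A" and g = g and x = f])
    show "\<exists>C. signed_circuit A C \<and> x \<in> supp C \<and> restricts C c"
      if "c \<in> cycle_chains A" "simple_chain c" "x \<in> supp c" for c x
      using cycle_restricts[OF rank that] by blast
  qed (use ab simple f_supp through_g in
      \<open>auto intro: cycle_chains_closed signed_circuit_cycle simp: signed_cycle_or_cut_def\<close>)
  have b: "signed_cocircuit A b"
  proof (rule restricts_all_imp_eq[where L = "cut_chains A" and g = g and x = f])
    show "\<exists>C. signed_cocircuit A C \<and> x \<in> supp C \<and> restricts C c"
      if "c \<in> cut_chains A" "simple_chain c" "x \<in> supp c" for c x
      using cut_restricts[OF rank that] by blast
  qed (use ab simple f_supp through_g in
      \<open>auto intro: cut_chains_closed signed_cocircuit_cut simp: signed_cycle_or_cut_def\<close>)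
  have "supp a \<inter> supp b = {f, g}"
    using others f_supp ag by (auto simp: supp_def)
  then show thesis
    using that[OF a b _ g(1)] ab(3) not_all ag by (auto simp: d_def)
qed

theorem theorem3p6:
  fixes A :: "'e::finite row_matrix"
    and \<sigma> \<sigma>' :: "'e signature"
    and F :: "'e chain" and f :: 'e
    and O\<^sub>1 O\<^sub>2 :: "'e orientation"
  assumes "full_row_rank A"
    and "totally_unimodular A"
    and "triangulating A \<sigma> \<sigma>'"
    and "is_arc F"
    and "supp F = {f}"
    and "compatible_orientation A \<sigma> \<sigma>' O\<^sub>1"
    and "compatible_orientation A \<sigma> \<sigma>' O\<^sub>2"
    and "orientation_action A \<sigma> \<sigma>' (sandpile_class A F) O\<^sub>1 = Some O\<^sub>2"
  shows "\<exists>c\<^sub>1 c\<^sub>3 Q\<^sub>1 Q\<^sub>2.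
      optional_reversal A f c\<^sub>1 O\<^sub>1 Q\<^sub>1 \<and>
      Q\<^sub>2 = reverse_on {f} Q\<^sub>1 \<and>
      optional_reversal A f c\<^sub>3 Q\<^sub>2 O\<^sub>2 \<and>
      (c\<^sub>1 \<noteq> None \<longleftrightarrow> agrees F O\<^sub>1) \<and>
      (c\<^sub>3 \<noteq> None \<longleftrightarrow> agrees (- F) O\<^sub>2) \<and>
      (\<forall>C D. c\<^sub>1 = Some C \<and> c\<^sub>3 = Some D \<longrightarrow>
         (signed_circuit A C \<and> signed_cocircuit A D) \<or>
         (signed_cocircuit A C \<and> signed_circuit A D)) \<and>
      (\<forall>C D. signed_circuit A C \<and> signed_cocircuit A D \<and>
         (c\<^sub>1 = Some C \<and> c\<^sub>3 = Some D \<or> c\<^sub>1 = Some D \<and> c\<^sub>3 = Some C) \<longrightarrow>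
         (\<exists>g. g \<noteq> f \<and> supp C \<inter> supp D = {f, g} \<and>
              O\<^sub>2 = reverse_on ((supp C \<union> supp D) - {g}) O\<^sub>1))"
proof -
  note rank = assms(1,2)
  have Fs: "simple_chain F" using assms(4) by (simp add: is_arc_def)
  have F: "agrees F Q \<longleftrightarrow> (F $ f > 0 \<longleftrightarrow> Q f = Plus)" "agrees (- F) Q \<longleftrightarrow> \<not> agrees F Q" for Q
    using assms(5) by (auto simp: agrees_iff supp_def)
  have rev_f: "reverse_on {f} Q f = opposite (Q f)" for Q by (simp add: reverse_on_def)
  have flip: "agrees F (reverse_on {f} Q) \<longleftrightarrow> \<not> agrees F Q" for Q
    by (auto simp: F(1) rev_f opposite_iff)
  have rev: "agrees F (reverse_on (supp C) Q) \<longleftrightarrow> \<not> agrees F Q" if "f \<in> supp C" for C Q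
    using that by (auto simp: F(1) reverse_on_def opposite_iff)
  have mem: "orient_chain O\<^sub>2 - orient_chain O\<^sub>1 - F \<in> cycle_cut_chains A"
    using orientation_action_chain[OF rank assms(4,8)] .
  have mem': "orient_chain O\<^sub>1 - orient_chain O\<^sub>2 + F \<in> cycle_cut_chains A"
    using cycle_cut_chains_minus[OF mem] by (simp add: algebra_simps)
  \<comment> \<open>The signs at \<open>f\<close> decide where reversals occur: none in step (1),
    only in step (1), or in both steps.\<close>
  consider "agrees (- F) O\<^sub>1" | "agrees F O\<^sub>1" "agrees F O\<^sub>2" | "agrees F O\<^sub>1" "agrees (- F) O\<^sub>2"
    using F(2) by blast
  then show ?thesis
  proof cases
    case 1
    have "orient_chain (reverse_on {f} O\<^sub>1) = orient_chain O\<^sub>1 + F"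
      using orient_chain_reverse[of "- F" O\<^sub>1] 1 Fs assms(5) by simp
    then have "orient_chain (reverse_on {f} O\<^sub>1) - orient_chain O\<^sub>2 \<in> cycle_cut_chains A"
      using mem' by (simp add: algebra_simps)
    then consider "O\<^sub>2 = reverse_on {f} O\<^sub>1"
      | C where "signed_cycle_or_cut A C" "f \<in> supp C" "agrees C (reverse_on {f} O\<^sub>1)"
        "O\<^sub>2 = reverse_on (supp C) (reverse_on {f} O\<^sub>1)"
      by (rule flip_then_reverse[OF rank assms(6,7)])
    then show ?thesis
    proof cases
      case 1
      then show ?thesis using \<open>agrees (- F) O\<^sub>1\<close> F(2) flip
        by - (rule exI[of _ None],
            rule exI[of _ None],
            rule exI[of _ O\<^sub>1],
            rule exI[of _ "reverse_on {f} O\<^sub>1"],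
            auto simp: optional_reversal_def)
    next
      case (2 C)
      then show ?thesis using \<open>agrees (- F) O\<^sub>1\<close> F(2) flip rev
        by - (rule exI[of _ None],
            rule exI[of _ "Some C"],
            rule exI[of _ O\<^sub>1],
            rule exI[of _ "reverse_on {f} O\<^sub>1"],
            auto simp: optional_reversal_def signed_cycle_or_cut_def)
    qed
  next
    \<comment> \<open>The process is run backwards, from \<open>O\<^sub>2\<close> to
      \<open>O\<^sub>1\<close>.\<close>
    case 2
    have "orient_chain (reverse_on {f} O\<^sub>2) = orient_chain O\<^sub>2 - F"
      using orient_chain_reverse[OF Fs 2(2)] assms(5) by simp
    then have "orient_chain (reverse_on {f} O\<^sub>2) - orient_chain O\<^sub>1
        = orient_chain O\<^sub>2 - orient_chain O\<^sub>1 - F" by simp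
    then have "orient_chain (reverse_on {f} O\<^sub>2) - orient_chain O\<^sub>1 \<in> cycle_cut_chains A"
      using mem by (simp only:)
    then consider "O\<^sub>1 = reverse_on {f} O\<^sub>2"
      | C where "signed_cycle_or_cut A C" "f \<in> supp C" "agrees C (reverse_on {f} O\<^sub>2)"
        "O\<^sub>1 = reverse_on (supp C) (reverse_on {f} O\<^sub>2)"
      by (rule flip_then_reverse[OF rank assms(7,6)])
    then show ?thesis
    proof cases
      case 1
      then show ?thesis using 2 flip by blast
    next
      case (2 C)
      \<comment> \<open>Undoing the backward reversal of \<open>C\<close> is the reversal of
        \<open>- C\<close> in \<open>O\<^sub>1\<close>.\<close>
      have "agrees (- C) O\<^sub>1" unfolding 2(4) by (rule agrees_minus_reverse[OF 2(3)])
      moreover have "reverse_on (supp C) O\<^sub>1 = reverse_on {f} O\<^sub>2"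
        unfolding 2(4) by (rule reverse_on_twice)
      moreover have "reverse_on {f} (reverse_on {f} O\<^sub>2) = O\<^sub>2" by (rule reverse_on_twice)
      ultimately show ?thesis
        using 2(1,2) signed_cycle_or_cut_minus[OF 2(1)] \<open>agrees F O\<^sub>1\<close> \<open>agrees F O\<^sub>2\<close> F(2)
        by - (rule exI[of _ "Some (- C)"],
            rule exI[of _ None],
            rule exI[of _ "reverse_on {f} O\<^sub>2"],
            rule exI[of _ O\<^sub>2],
            auto simp: optional_reversal_def signed_cycle_or_cut_def)
    qed
  next
    case 3
    obtain C D g where CD: "signed_circuit A C" "signed_cocircuit A D"
      and sum: "orient_chain O\<^sub>1 - orient_chain O\<^sub>2 + F = C + D"
      and g: "g \<noteq> f" "supp C \<inter> supp D = {f, g}" "C $ f = F $ f" "D $ f = F $ f" "C $ g = - D $ g"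
      by (rule opposite_arc_cycle_and_cut[OF rank assms(4,5,6,7) mem' 3])
    have simple: "simple_chain C" "simple_chain D"
      using CD by (auto simp: signed_circuit_def signed_cocircuit_def)
    have g': "supp D \<inter> supp C = {f, g}" "D $ g = - C $ g" "C $ g \<noteq> 0"
      and sum': "orient_chain O\<^sub>1 - orient_chain O\<^sub>2 + F = D + C"
      using g sum by (auto simp: supp_def add.commute)
    have fCD: "f \<in> supp C" "f \<in> supp D" using g(2) by auto
    show ?thesis
    \<comment> \<open>The circuit and the cocircuit have opposite signs at \<open>g\<close>, so
      exactly one of them agrees with \<open>O\<^sub>1\<close> there, and that one goes
      first.\<close>
    proof (cases "C $ g > 0 \<longleftrightarrow> O\<^sub>1 g = Plus")
      case True
      note two = two_reversals[OF simple g(2,1) assms(5) g(3,4,5) sum True 3(1)]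
      show ?thesis
        using two two(4)[unfolded Un_commute[of "supp C" "supp D"]]
          two(4)[unfolded Un_commute[of "supp D" "supp C"]] CD fCD 3 g(1,2) g'(1)
        by - (rule exI[of _ "Some C"],
            rule exI[of _ "Some D"],
            rule exI[of _ "reverse_on (supp C) O\<^sub>1"],
            rule exI[of _ "reverse_on {f} (reverse_on (supp C) O\<^sub>1)"],
            auto simp: optional_reversal_def)
    next
      case False
      then have "D $ g > 0 \<longleftrightarrow> O\<^sub>1 g = Plus" using g'(2,3) by auto
      note two = two_reversals[OF simple(2,1) g'(1) g(1) assms(5) g(4,3) g'(2) sum' this 3(1)]
      show ?thesis
        using two two(4)[unfolded Un_commute[of "supp C" "supp D"]]
          two(4)[unfolded Un_commute[of "supp D" "supp C"]] CD fCD 3 g(1,2) g'(1)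
        by - (rule exI[of _ "Some D"],
            rule exI[of _ "Some C"],
            rule exI[of _ "reverse_on (supp D) O\<^sub>1"],
            rule exI[of _ "reverse_on {f} (reverse_on (supp D) O\<^sub>1)"],
            auto simp: optional_reversal_def)
    qed
  qed
qed

end
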